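(* Almost surely on the event that $(\hat\imath_1,\ldots,\hat\imath_K)$ satisfies the Irrepresentable Check, the conditional distribution of $(\lambda_1,\ldots,\lambda_K)$ given $(\hat\imath_1,\ldots,\hat\imath_K,\lambda_{K+1})$ has density with respect to Lebesgue measure on $\mathbb R^K$, at the point $(\ell_1,\ldots,\ell_K)$, equal to $$Q^{-1}\Big(\prod_{k=1}^K\varphi_{m_k,v_k^2}(\ell_k)\Big)\,\mathbf 1_{\{\ell_1\ge\ell_2\ge\cdots\ge\ell_K\ge\lambda_{K+1}\}},$$ where $Q=Q_{(\hat\imath_1,\ldots,\hat\imath_K,\lambda_{K+1})}$ is a normalizing constant, $\varphi_{m,v^2}$ is the Gaussian density with mean $m$ and variance $v^2$, $v_k^2=\sigma^2\rho_k^2$, and $m_k,\rho_k$ (functions of $\hat\imath_1,\ldots,\hat\imath_k$) are defined in the context.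
   Context: Notation: $[m]=\{1,\ldots,m\}$. Let $X\in\mathbb R^{n\times p}$ be a fixed matrix of rank $r>0$ with columns $X_1,\ldots,X_p$, and $Y=X\beta^0+\eta$ with $\beta^0\in\mathbb R^p$, $\eta\sim\mathcal N_n(0,\sigma^2\mathrm{Id}_n)$, $\sigma>0$. $K$ is a fixed integer with $1\le K<\min(n,r)$. Signed indices: $i\in[2p]$ encodes a variable $j\in[p]$ and a sign $s\in\{\pm1\}$ via $i=j+p\frac{1-s}{2}$. Put $\bar Z=X^\top Y$, $Z=(\bar Z,-\bar Z)\in\mathbb R^{2p}$, with mean $\mu^0=(X^\top X\beta^0,-X^\top X\beta^0)$ and covariance $\sigma^2R$, $R=\begin{pmatrix}X^\top X&-X^\top X\\-X^\top X&X^\top X\end{pmatrix}$. For $i_1,\ldots,i_k\in[2p]$ let $M_{i_1,\ldots,i_k}$ be the submatrix of $R$ with rows and columns indexed by $i_1,\ldots,i_k$, and for $j\in[2p]$ let $\theta_j(i_1,\ldots,i_k)=(R_{j,i_1}\cdots R_{j,i_k})M_{i_1,\ldots,i_k}^{-1}(1,\ldots,1)^\top$ and $\Pi_{i_1,\ldots,i_k}(Z_j)=(R_{j,i_1}\cdots R_{j,i_k})M_{i_1,\ldots,i_k}^{-1}(Z_{i_1},\ldots,Z_{i_k})^\top$ (both are $0$ when $k=0$). LARS (Least Angle Regression) knots $\lambda_1\ge\lambda_2\ge\cdots$ and signed variables $\hat\imath_1,\hat\imath_2,\ldots\in[2p]$: for $k\ge1$, $$\lambda_k=\max_{j:\,\theta_j(\hat\imath_1,\ldots,\hat\imath_{k-1})<1}\frac{Z_j-\Pi_{\hat\imath_1,\ldots,\hat\imath_{k-1}}(Z_j)}{1-\theta_j(\hat\imath_1,\ldots,\hat\imath_{k-1})},$$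 and $\hat\imath_k$ is the corresponding argmax. $\mathcal A_K$ is the set of $(i_1,\ldots,i_K)\in[2p]^K$ whose underlying variables $j_1,\ldots,j_K\in[p]$ are pairwise different. $(i_1,\ldots,i_K)\in\mathcal A_K$ satisfies the Irrepresentable Check if for all $k\in[K]$ the matrix $M_{i_1,\ldots,i_k}$ is invertible and $\theta_j(i_1,\ldots,i_k)<1$ for all $j\in[2p]\setminus\{i_1,\ldots,i_k\}$. Means and scales: $m_1=\mu^0_{\hat\imath_1}$, $\rho_1=\sqrt{R_{\hat\imath_1,\hat\imath_1}}$ and, for $k\ge2$, $$m_k=\frac{\mu^0_{\hat\imath_k}-(R_{\hat\imath_k,\hat\imath_1}\cdots R_{\hat\imath_k,\hat\imath_{k-1}})M^{-1}_{\hat\imath_1,\ldots,\hat\imath_{k-1}}(\mu^0_{\hat\imath_1},\ldots,\mu^0_{\hat\imath_{k-1}})^\top}{1-\theta_{\hat\imath_k}(\hat\imath_1,\ldots,\hat\imath_{k-1})},$$ $$\rho_k=\frac{\sqrt{R_{\hat\imath_k,\hat\imath_k}-(R_{\hat\imath_k,\hat\imath_1}\cdots R_{\hat\imath_k,\hat\imath_{k-1}})M^{-1}_{\hat\imath_1,\ldots,\hat\imath_{k-1}}(R_{\hat\imath_k,\hat\imath_1},\ldots,R_{\hat\imath_k,\hat\imath_{k-1}})^\top}}{1-\theta_{\hat\imath_k}(\hat\imath_1,\ldots,\hat\imath_{k-1})}.$$ *)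

theory Defs
  imports
    "HOL-Probability.Probability"
    "Jordan_Normal_Form.Gauss_Jordan_Elimination"
begin

no_notation vec_index (infixl "$" 100)

text \<open>
  A signed index \<open>i = j + p (1 - s) / 2\<close> is an element of the sum type \<^typ>\<open>'p + 'p\<close>:
  \<open>Inl j\<close> is the variable \<open>j\<close> with sign \<open>s = 1\<close>, and \<open>Inr j\<close> is the variable \<open>j\<close> with
  sign \<open>s = -1\<close>. A tuple \<open>(i\<^sub>1, \<dots>, i\<^sub>k)\<close> of signed indices is a list.
\<close>

definition signed_var :: "'p + 'p \<Rightarrow> 'p" where
  "signed_var i = (case i of Inl j \<Rightarrow> j | Inr j \<Rightarrow> j)"

definition signed_vec :: "real ^ 'p::finite \<Rightarrow> real ^ ('p + 'p)" where
  "signed_vec z = (\<chi> i. case i of Inl j \<Rightarrow> z $ j | Inr j \<Rightarrow> - z $ j)"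

definition signed_gram :: "real ^ 'p::finite ^ 'n::finite \<Rightarrow> real ^ ('p + 'p) ^ ('p + 'p)" where
  "signed_gram X = (let G = transpose X ** X in
     (\<chi> i i'. case (i, i') of
        (Inl j, Inl j') \<Rightarrow> G $ j $ j'
      | (Inl j, Inr j') \<Rightarrow> - G $ j $ j'
      | (Inr j, Inl j') \<Rightarrow> - G $ j $ j'
      | (Inr j, Inr j') \<Rightarrow> G $ j $ j'))"

definition lars_M :: "real ^ 'p::finite ^ 'n::finite \<Rightarrow> ('p + 'p) list \<Rightarrow> real mat" where
  "lars_M X is = Matrix.mat (length is) (length is) (\<lambda>(a, b). signed_gram X $ (is ! a) $ (is ! b))"

text \<open>
  The number \<open>(R\<^bsub>j,i\<^sub>1\<^esub> \<dots> R\<^bsub>j,i\<^sub>k\<^esub>) M\<^sup>-\<^sup>1 (f i\<^sub>1, \<dots>, f i\<^sub>k)\<^sup>T\<close>. It is \<open>0\<close> for the empty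
  tuple. For singular \<open>M\<close> the inverse is the unspecified value \<open>the None\<close>.
\<close>

definition lars_proj ::
  "real ^ 'p::finite ^ 'n::finite \<Rightarrow> ('p + 'p) list \<Rightarrow> ('p + 'p \<Rightarrow> real) \<Rightarrow> 'p + 'p \<Rightarrow> real" where
  "lars_proj X is f j =
     scalar_prod (Matrix.vec (length is) (\<lambda>a. signed_gram X $ j $ (is ! a)))
       (mult_mat_vec (the (mat_inverse (lars_M X is))) (Matrix.vec (length is) (\<lambda>a. f (is ! a))))"

definition lars_theta :: "real ^ 'p::finite ^ 'n::finite \<Rightarrow> ('p + 'p) list \<Rightarrow> 'p + 'p \<Rightarrow> real" where
  "lars_theta X is j = lars_proj X is (\<lambda>_. 1) j"

definition lars_Pi ::
  "real ^ 'p::finite ^ 'n::finite \<Rightarrow> ('p + 'p) list \<Rightarrow> real ^ ('p + 'p) \<Rightarrow> 'p + 'p \<Rightarrow> real" where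
  "lars_Pi X is Z j = lars_proj X is (\<lambda>i. Z $ i) j"

text \<open>
  \<open>lam 1, \<dots>, lam N\<close> and \<open>ih 1, \<dots>, ih N\<close> are the first \<open>N\<close> knots and signed variables of LARS
  for the response \<open>y\<close>. No rule is imposed for breaking ties in the argmax.
\<close>

definition lars_path ::
  "real ^ 'p::finite ^ 'n::finite \<Rightarrow> real ^ 'n \<Rightarrow> nat \<Rightarrow> (nat \<Rightarrow> real) \<Rightarrow> (nat \<Rightarrow> 'p + 'p) \<Rightarrow> bool" where
  "lars_path X y N lam ih \<longleftrightarrow>
     (\<forall>k\<in>{1..N}.
        let Z = signed_vec (transpose X *v y);
            is = map ih [1..<k];
            C = {j. lars_theta X is j < 1};
            g = (\<lambda>j. (Z $ j - lars_Pi X is Z j) / (1 - lars_theta X is j))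
        in lam k = Max (g ` C) \<and> is_arg_max g (\<lambda>j. j \<in> C) (ih k))"

definition lars_tuples :: "nat \<Rightarrow> ('p + 'p) list set" where
  "lars_tuples K = {is. length is = K \<and> distinct (map signed_var is)}"

definition irrepresentable_check :: "real ^ 'p::finite ^ 'n::finite \<Rightarrow> ('p + 'p) list \<Rightarrow> bool" where
  "irrepresentable_check X is \<longleftrightarrow>
     (\<forall>k\<in>{1..length is}.
        invertible_mat (lars_M X (take k is)) \<and>
        (\<forall>j. j \<notin> set (take k is) \<longrightarrow> lars_theta X (take k is) j < 1))"

text \<open>
  \<open>lars_mean\<close> and \<open>lars_scale\<close> are \<open>m\<^sub>k\<close> and \<open>\<rho>\<^sub>k\<close> at the tuple \<open>is = (i\<^sub>1, \<dots>, i\<^sub>K)\<close>, with \<open>k\<close>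
  counted from 1, so that \<open>i\<^sub>k = is ! (k - 1)\<close>. For \<open>k = 1\<close> the projection and \<open>\<theta>\<close> vanish, which
  leaves \<open>\<mu>\<^bsub>i\<^sub>1\<^esub>\<close> and \<open>sqrt R\<^bsub>i\<^sub>1,i\<^sub>1\<^esub>\<close>.
\<close>

definition lars_mean ::
  "real ^ 'p::finite ^ 'n::finite \<Rightarrow> real ^ 'p \<Rightarrow> ('p + 'p) list \<Rightarrow> nat \<Rightarrow> real" where
  "lars_mean X \<beta> is k =
     (let \<mu> = signed_vec ((transpose X ** X) *v \<beta>); prev = take (k - 1) is; i = is ! (k - 1)
      in (\<mu> $ i - lars_proj X prev (\<lambda>i'. \<mu> $ i') i) / (1 - lars_theta X prev i))"

definition lars_scale :: "real ^ 'p::finite ^ 'n::finite \<Rightarrow> ('p + 'p) list \<Rightarrow> nat \<Rightarrow> real" where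
  "lars_scale X is k =
     (let R = signed_gram X; prev = take (k - 1) is; i = is ! (k - 1)
      in sqrt (R $ i $ i - lars_proj X prev (\<lambda>i'. R $ i $ i') i) / (1 - lars_theta X prev i))"

text \<open>
  The density before normalization, at \<open>l\<close>, when the selected tuple is \<open>is\<close> and the knot of
  index \<open>length is + 1\<close> is \<open>x\<close>. The second parameter of \<^const>\<open>normal_density\<close> is the standard
  deviation.
\<close>

definition lars_weight ::
  "real ^ 'p::finite ^ 'n::finite \<Rightarrow> real ^ 'p \<Rightarrow> real \<Rightarrow> ('p + 'p) list \<Rightarrow> real \<Rightarrow> (nat \<Rightarrow> real) \<Rightarrow> real" where
  "lars_weight X \<beta> \<sigma> is x l =
     (let K = length is in
      (\<Prod>k=1..K. normal_density (lars_mean X \<beta> is k) (\<sigma> * lars_scale X is k) (l k)) *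
      indicator {l. (\<forall>k\<in>{1..<K}. l k \<ge> l (k + 1)) \<and> l K \<ge> x} l)"

definition lars_Q ::
  "real ^ 'p::finite ^ 'n::finite \<Rightarrow> real ^ 'p \<Rightarrow> real \<Rightarrow> ('p + 'p) list \<Rightarrow> real \<Rightarrow> real" where
  "lars_Q X \<beta> \<sigma> is x =
     (LINT l|PiM {1..length is} (\<lambda>_. lborel). lars_weight X \<beta> \<sigma> is x l)"

definition lars_cond_law ::
  "real ^ 'p::finite ^ 'n::finite \<Rightarrow> real ^ 'p \<Rightarrow> real \<Rightarrow> ('p + 'p) list \<Rightarrow> real \<Rightarrow> (nat \<Rightarrow> real) measure" where
  "lars_cond_law X \<beta> \<sigma> is x =
     density (PiM {1..length is} (\<lambda>_. lborel))
       (\<lambda>l. ennreal (inverse (lars_Q X \<beta> \<sigma> is x) * lars_weight X \<beta> \<sigma> is x l))"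

text \<open>
  Almost surely on the event \<open>V \<in> B\<close>, the conditional distribution of \<open>U\<close> given \<open>V\<close> is \<open>\<kappa> (V)\<close>:
  \<open>\<kappa>\<close> is a probability kernel on \<open>B\<close>, and \<open>P(U \<in> A | V) = \<kappa> (V) A\<close> almost surely on this event,
  for every measurable \<open>A\<close>.
\<close>

definition cond_distr_on ::
  "'a measure \<Rightarrow> 'b measure \<Rightarrow> ('a \<Rightarrow> 'b) \<Rightarrow> 'c measure \<Rightarrow> ('a \<Rightarrow> 'c) \<Rightarrow> 'c set \<Rightarrow> ('c \<Rightarrow> 'b measure) \<Rightarrow> bool"
  where
  "cond_distr_on M S U T V B \<kappa> \<longleftrightarrow>
     U \<in> M \<rightarrow>\<^sub>M S \<and> V \<in> M \<rightarrow>\<^sub>M T \<and> B \<in> sets T \<and>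
     \<kappa> \<in> restrict_space T B \<rightarrow>\<^sub>M prob_algebra S \<and>
     (\<forall>A\<in>sets S. AE \<omega> in M. V \<omega> \<in> B \<longrightarrow>
        real_cond_exp M (vimage_algebra (space M) V T) (indicator (U -` A \<inter> space M)) \<omega>
          = measure (\<kappa> (V \<omega>)) A)"

end

theory Submission
  imports Defs
begin

text \<open>
  Fix a tuple \<open>i\<^sub>1, \<dots>, i\<^sub>K\<close> that passes the Irrepresentable Check and freeze it: replace the
  selected variables in the formulas for the knots by these indices. The frozen knot of index \<open>k\<close>
  is \<open>(w\<^sub>k \<bullet> Y) / d\<^sub>k\<close>. Here \<open>w\<^sub>k\<close> is the part of the signed column of \<open>i\<^sub>k\<close> orthogonal to the
  earlier columns, and \<open>d\<^sub>k > 0\<close> is one minus the \<open>\<theta>\<close> of \<open>i\<^sub>k\<close> with respect to them.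
  The \<open>w\<^sub>k\<close> are nonzero and orthogonal by Gram-Schmidt, so the frozen knots are independent
  normal variables with the means and scales of the statement. The frozen version of
  \<open>\<lambda>\<^bsub>K+1\<^esub>\<close> is a maximum of functions of the part of \<open>Y\<close> orthogonal to all \<open>w\<^sub>k\<close>, so it is
  independent of them (\<open>frozen_knots_law\<close>, which rests on the rotation invariance of the
  Gaussian law, \<open>gaussian_projections_law\<close>).

  The frozen knots matter because they detect the selection: up to ties, the tuple is selected if
  and only if its frozen knots, followed by the frozen top, decrease
  (\<open>AE_selected_iff_ordered\<close>). The reason is that at the value of the \<open>k\<close>-th knot the
  correlations before and after \<open>i\<^sub>k\<close> enters coincide, so that a competitor lies above this
  value before the step exactly if it does after it (\<open>ratio_crossing\<close>). One direction
  follows from the maximality of each knot; the other by descending along the tuple from the top.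
  Ties are hyperplanes in the space of the noise, hence null sets.

  So on the event that a given tuple is selected, \<open>(\<lambda>\<^sub>1, \<dots>, \<lambda>\<^sub>K, \<lambda>\<^bsub>K+1\<^esub>)\<close> has the law of
  \<open>K\<close> independent normal variables times the law of the frozen top, restricted to decreasing
  sequences (\<open>selected_tuple_integral\<close>). By Fubini, fixing the last coordinate leaves the
  product density restricted to decreasing sequences above it, and its total mass is the
  normalizing constant. Summing over the finitely many tuples gives the integral identity that
  characterizes the conditional distribution (\<open>cond_distr_onI\<close>).
\<close>

(* The symbol is kept for the inner product of Euclidean spaces. *)
no_notation scalar_prod (infix "\<bullet>" 70)

section \<open>Rotation invariance and projections of Gaussian vectors\<close>

lemma nn_integral_lborel_shift:
  fixes f :: "'a::euclidean_space \<Rightarrow> ennreal"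
  assumes [measurable]: "f \<in> borel_measurable borel"
  shows "(\<integral>\<^sup>+x. f (c + x) \<partial>lborel) = (\<integral>\<^sup>+x. f x \<partial>lborel)"
proof -
  have "(\<integral>\<^sup>+x. f x \<partial>lborel) = (\<integral>\<^sup>+x. f x \<partial>distr lborel borel ((+) c))"
    by (simp add: lborel_distr_plus)
  also have "\<dots> = (\<integral>\<^sup>+x. f (c + x) \<partial>lborel)" by (intro nn_integral_distr) auto
  finally show ?thesis ..
qed

text \<open>
  The argument for the uniqueness of Haar measure, applied to the image measure. Integrate
  \<open>1\<^sub>B(y) 1\<^sub>A(T x + y)\<close> over \<open>x\<close> and \<open>y\<close> in both orders, where \<open>B\<close> is the unit ball. Translation
  invariance turns one order into \<open>|B|\<close> times the image measure of \<open>A\<close>. Since \<open>T\<close> maps \<open>B\<close> onto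
  itself, the other order gives \<open>|B| |A|\<close>.
\<close>

lemma distr_lborel_orthogonal:
  fixes T :: "'a::euclidean_space \<Rightarrow> 'a"
  assumes T: "orthogonal_transformation T"
  shows "distr lborel borel T = lborel"
proof (rule measure_eqI)
  define S where "S = inv_into UNIV T"
  have S: "orthogonal_transformation S" unfolding S_def by (rule orthogonal_transformation_inv[OF T])
  have TS: "T (S x) = x" "S (T x) = x" for x
    using orthogonal_transformation_bij[OF T]
    by (simp_all add: S_def bij_def surj_f_inv_f inv_f_f)
  have lin: "linear T" "linear S" using T S by (auto intro: orthogonal_transformation_linear)
  have [measurable]: "T \<in> borel_measurable borel"
    by (intro borel_measurable_continuous_onI linear_continuous_on linear_conv_bounded_linear[THEN iffD1] lin)
  define B :: "'a set" where "B = ball 0 1"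
  define b where "b = emeasure lborel B"
  have [measurable]: "B \<in> sets borel" by (simp add: B_def)
  fix A assume "A \<in> sets (distr lborel borel T)"
  then have [measurable]: "A \<in> sets borel" by simp
  have "b * emeasure (distr lborel borel T) A = (\<integral>\<^sup>+y. indicator B y * (\<integral>\<^sup>+x. indicator A (T x) \<partial>lborel) \<partial>lborel)"
    using nn_integral_distr[of T lborel borel "indicator A"] by (simp add: b_def nn_integral_multc)
  also have "\<dots> = (\<integral>\<^sup>+y. (\<integral>\<^sup>+x. indicator B y * indicator A (T x) \<partial>lborel) \<partial>lborel)"
    by (simp add: nn_integral_cmult)
  also have "\<dots> = (\<integral>\<^sup>+y. (\<integral>\<^sup>+x. indicator B y * indicator A (T x + y) \<partial>lborel) \<partial>lborel)"
  proof (rule nn_integral_cong)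
    fix y
    show "(\<integral>\<^sup>+x. indicator B y * indicator A (T x) \<partial>lborel) = (\<integral>\<^sup>+x. indicator B y * indicator A (T x + y) \<partial>lborel)"
      by (subst nn_integral_lborel_shift[of _ "S y", symmetric])
        (auto simp: linear_add[OF lin(1)] TS add.commute)
  qed
  also have "\<dots> = (\<integral>\<^sup>+x. (\<integral>\<^sup>+y. indicator B y * indicator A (T x + y) \<partial>lborel) \<partial>lborel)"
    by (rule lborel_pair.Fubini') simp
  also have "\<dots> = (\<integral>\<^sup>+x. (\<integral>\<^sup>+y. indicator B (y - T x) * indicator A y \<partial>lborel) \<partial>lborel)"
  proof (rule nn_integral_cong)
    fix x
    show "(\<integral>\<^sup>+y. indicator B y * indicator A (T x + y) \<partial>lborel) = (\<integral>\<^sup>+y. indicator B (y - T x) * indicator A y \<partial>lborel)"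
      by (subst nn_integral_lborel_shift[of "\<lambda>y. indicator B (y - T x) * indicator A y" "T x", symmetric]) auto
  qed
  also have "\<dots> = (\<integral>\<^sup>+y. (\<integral>\<^sup>+x. indicator B (y - T x) * indicator A y \<partial>lborel) \<partial>lborel)"
    by (rule lborel_pair.Fubini') simp
  also have "\<dots> = (\<integral>\<^sup>+y. b * indicator A y \<partial>lborel)"
  proof (rule nn_integral_cong)
    fix y
    have "y - T (S y + x) \<in> B \<longleftrightarrow> x \<in> B" for x
      by (simp add: linear_add[OF lin(1)] TS B_def orthogonal_transformation_norm[OF T])
    then have "(\<integral>\<^sup>+x. indicator B (y - T (S y + x)) \<partial>lborel) = b"
      by (simp add: indicator_def b_def nn_integral_indicator[symmetric] del: nn_integral_indicator)
    then have "(\<integral>\<^sup>+x. indicator B (y - T x) \<partial>lborel) = b"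
      by (subst (asm) nn_integral_lborel_shift) auto
    then show "(\<integral>\<^sup>+x. indicator B (y - T x) * indicator A y \<partial>lborel) = b * indicator A y"
      by (simp add: nn_integral_multc)
  qed
  also have "\<dots> = b * emeasure lborel A" by (simp add: nn_integral_cmult)
  finally have *: "b * emeasure (distr lborel borel T) A = b * emeasure lborel A" .
  have "b \<noteq> \<infinity>" using emeasure_lborel_ball_finite[of "0::'a" 1] by (simp add: b_def B_def)
  moreover have "b \<noteq> 0" using content_ball_pos[of 1 "0::'a"] by (auto simp: b_def B_def measure_def)
  ultimately show "emeasure (distr lborel borel T) A = emeasure lborel A"
    using * by (simp add: ennreal_mult_cancel_left)
qed simp

text \<open>
  Boxes determine Lebesgue measure, so it is the image of the product measure under \<^const>\<open>vec_lambda\<close>;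
  the components are the inverse map.
\<close>

lemma distr_lborel_components:
  "distr lborel (PiM UNIV (\<lambda>_. lborel)) (\<lambda>(x::real^'n::finite) i. x $ i) = PiM UNIV (\<lambda>_. lborel)"
proof -
  interpret product_sigma_finite "\<lambda>_::'n. lborel :: real measure" ..
  let ?P = "PiM UNIV (\<lambda>_::'n. lborel :: real measure)"
  have vec[measurable]: "vec_lambda \<in> ?P \<rightarrow>\<^sub>M (borel :: (real^'n) measure)"
  proof (subst borel_measurable_euclidean_space, intro ballI)
    fix b :: "real^'n" assume "b \<in> Basis"
    then obtain i where "b = axis i 1" by (auto simp: Basis_vec_def)
    then show "(\<lambda>x. vec_lambda x \<bullet> b) \<in> borel_measurable ?P"
      by (simp add: inner_axis)
  qed
  have nth[measurable]: "(\<lambda>(x::real^'n) i. x $ i) \<in> borel \<rightarrow>\<^sub>M ?P"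
    by (rule measurable_PiM_single') (auto simp: space_PiM)
  have "(lborel :: (real^'n) measure) = distr ?P borel vec_lambda"
  proof (rule lborel_eqI)
    fix l u :: "real^'n"
    assume le: "\<And>b. b \<in> Basis \<Longrightarrow> l \<bullet> b \<le> u \<bullet> b"
    have le': "l $ i \<le> u $ i" for i using le[of "axis i 1"] by (simp add: inner_axis axis_in_Basis_iff)
    have "emeasure (distr ?P borel vec_lambda) (box l u) = emeasure ?P (\<Pi>\<^sub>E i\<in>UNIV. {l $ i<..<u $ i})"
      by (subst emeasure_distr) (auto simp: space_PiM mem_box_cart PiE_def Pi_def intro!: arg_cong[where f="emeasure ?P"])
    also have "\<dots> = (\<Prod>i\<in>UNIV. ennreal (u $ i - l $ i))"
      using le' by (subst emeasure_PiM) auto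
    also have "\<dots> = ennreal (\<Prod>i\<in>UNIV. u $ i - l $ i)"
      using le' by (intro prod_ennreal) auto
    also have "(\<Prod>i\<in>UNIV. u $ i - l $ i) = (\<Prod>b\<in>Basis. (u - l) \<bullet> b)"
    proof -
      have "(Basis :: (real^'n) set) = (\<lambda>i. axis i 1) ` UNIV" by (auto simp: Basis_vec_def)
      then have "(\<Prod>b\<in>Basis. (u - l) \<bullet> b) = (\<Prod>b\<in>(\<lambda>i. axis i 1) ` UNIV. (u - l) \<bullet> b)"
        by (rule arg_cong)
      also have "\<dots> = (\<Prod>i\<in>UNIV. u $ i - l $ i)"
        by (subst prod.reindex) (auto simp: inj_on_def axis_eq_axis inner_axis)
      finally show ?thesis ..
    qed
    finally show "emeasure (distr ?P borel vec_lambda) (box l u) = ennreal (\<Prod>b\<in>Basis. (u - l) \<bullet> b)" .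
  qed simp
  then have "distr lborel ?P (\<lambda>(x::real^'n) i. x $ i) = distr (distr ?P borel vec_lambda) ?P (\<lambda>x i. x $ i)"
    by simp
  also have "\<dots> = distr ?P ?P (\<lambda>x. x)"
    by (subst distr_distr) (auto simp: o_def vec_lambda_inverse)
  finally show ?thesis by simp
qed

lemma density_PiM_lborel:
  fixes f :: "'i \<Rightarrow> real \<Rightarrow> ennreal"
  assumes I: "finite I" and [measurable]: "\<And>i. f i \<in> borel_measurable borel"
    and p: "\<And>i. i \<in> I \<Longrightarrow> prob_space (density lborel (f i))"
  shows "density (PiM I (\<lambda>_. lborel)) (\<lambda>x. \<Prod>i\<in>I. f i (x i)) = PiM I (\<lambda>i. density lborel (f i))"
proof -
  \<comment> \<open>The product locale wants a probability space at every index, so the uniform density on the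
    unit interval is put outside of \<open>I\<close>.\<close>
  define g where "g i = (if i \<in> I then f i else indicator {0..1})" for i
  have g[measurable]: "g i \<in> borel_measurable borel" for i by (simp add: g_def)
  have "prob_space (density lborel (g i))" for i
    using p by (auto simp: g_def emeasure_density intro!: prob_spaceI)
  then interpret G: product_prob_space "\<lambda>i. density lborel (g i)" by (rule product_prob_spaceI)
  interpret L: product_sigma_finite "\<lambda>_::'i. lborel :: real measure" ..
  have "density (PiM I (\<lambda>_. lborel)) (\<lambda>x. \<Prod>i\<in>I. g i (x i)) = PiM I (\<lambda>i. density lborel (g i))"
  proof (rule G.PiM_eqI[OF I])
    show "sets (density (PiM I (\<lambda>_. lborel)) (\<lambda>x. \<Prod>i\<in>I. g i (x i))) = sets (PiM I (\<lambda>i. density lborel (g i)))"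
      by (auto intro!: sets_PiM_cong)
    fix A assume A: "\<And>i. i \<in> I \<Longrightarrow> A i \<in> sets (density lborel (g i))"
    then have A': "Pi\<^sub>E I A \<in> sets (PiM I (\<lambda>_. lborel))" using I by (auto intro!: sets_PiM_I_finite)
    have "emeasure (density (PiM I (\<lambda>_. lborel)) (\<lambda>x. \<Prod>i\<in>I. g i (x i))) (Pi\<^sub>E I A)
        = (\<integral>\<^sup>+x. (\<Prod>i\<in>I. g i (x i)) * indicator (Pi\<^sub>E I A) x \<partial>PiM I (\<lambda>_. lborel))"
      using A' by (subst emeasure_density) auto
    also have "\<dots> = (\<integral>\<^sup>+x. (\<Prod>i\<in>I. g i (x i) * indicator (A i) (x i)) \<partial>PiM I (\<lambda>_. lborel))"
    proof (rule nn_integral_cong)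
      fix x assume "x \<in> space (PiM I (\<lambda>_::'i. lborel :: real measure))"
      then have x: "x \<in> extensional I" by (auto simp: space_PiM PiE_def)
      show "(\<Prod>i\<in>I. g i (x i)) * indicator (Pi\<^sub>E I A) x = (\<Prod>i\<in>I. g i (x i) * indicator (A i) (x i))"
        using I x by (cases "x \<in> Pi\<^sub>E I A") (auto simp: PiE_def Pi_def indicator_def prod.distrib intro!: prod.cong prod_zero)
    qed
    also have "\<dots> = (\<Prod>i\<in>I. \<integral>\<^sup>+x. g i x * indicator (A i) x \<partial>lborel)"
      using A I by (intro L.product_nn_integral_prod) auto
    also have "\<dots> = (\<Prod>i\<in>I. emeasure (density lborel (g i)) (A i))"
      using A by (intro prod.cong) (auto simp: emeasure_density)
    finally show "emeasure (density (PiM I (\<lambda>_. lborel)) (\<lambda>x. \<Prod>i\<in>I. g i (x i))) (Pi\<^sub>E I A)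
        = (\<Prod>i\<in>I. emeasure (density lborel (g i)) (A i))" .
  qed
  then show ?thesis by (simp add: g_def cong: prod.cong PiM_cong)
qed

lemma gaussian_components:
  fixes \<xi> :: "'a \<Rightarrow> real ^ 'n::finite"
  assumes "prob_space M" and "\<sigma> > 0"
    and \<xi>: "distributed M lborel \<xi> (\<lambda>x. ennreal (\<Prod>i\<in>UNIV. normal_density 0 \<sigma> (x $ i)))"
  shows "prob_space.indep_vars M (\<lambda>_. borel) (\<lambda>i \<omega>. \<xi> \<omega> $ i) UNIV"
    and "distributed M lborel (\<lambda>\<omega>. \<xi> \<omega> $ i) (normal_density 0 \<sigma>)"
proof -
  interpret prob_space M by fact
  define N where "N = density lborel (\<lambda>x. ennreal (normal_density 0 \<sigma> x))"
  have N: "prob_space N" unfolding N_def using \<open>\<sigma> > 0\<close> by (rule prob_space_normal_density)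
  have \<xi>_meas[measurable]: "\<xi> \<in> M \<rightarrow>\<^sub>M borel" and \<xi>_distr: "distr M lborel \<xi> =
      density lborel (\<lambda>x. ennreal (\<Prod>i\<in>UNIV. normal_density 0 \<sigma> (x $ i)))"
    using \<xi> by (auto simp: distributed_def)
  let ?P = "PiM UNIV (\<lambda>_::'n. lborel :: real measure)"
  have nth[measurable]: "(\<lambda>(x::real^'n) i. x $ i) \<in> borel \<rightarrow>\<^sub>M ?P"
    by (rule measurable_PiM_single') (auto simp: space_PiM)
  have [measurable]: "(\<lambda>\<omega>. \<xi> \<omega> $ i) \<in> borel_measurable M" for i
    by (rule measurable_compose[OF \<xi>_meas]) (intro borel_measurable_continuous_onI continuous_intros)
  have "distr M ?P (\<lambda>\<omega> i. \<xi> \<omega> $ i) = distr (distr M lborel \<xi>) ?P (\<lambda>x i. x $ i)"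
    by (subst distr_distr) (auto simp: o_def)
  also have "\<dots> = distr (density lborel (\<lambda>x. \<Prod>i\<in>UNIV. ennreal (normal_density 0 \<sigma> (x $ i)))) ?P (\<lambda>x i. x $ i)"
    unfolding \<xi>_distr by (simp add: prod_ennreal)
  also have "\<dots> = density (distr lborel ?P (\<lambda>x i. x $ i)) (\<lambda>x. \<Prod>i\<in>UNIV. ennreal (normal_density 0 \<sigma> (x i)))"
    by (subst density_distr) auto
  also have "\<dots> = PiM UNIV (\<lambda>_::'n. N)"
    unfolding distr_lborel_components N_def
    using N by (intro density_PiM_lborel) (auto simp: N_def)
  finally have joint: "distr M ?P (\<lambda>\<omega> i. \<xi> \<omega> $ i) = PiM UNIV (\<lambda>_::'n. N)" .
  have marg: "distr M lborel (\<lambda>\<omega>. \<xi> \<omega> $ i) = N" for i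
  proof -
    have "distr M lborel (\<lambda>\<omega>. \<xi> \<omega> $ i) = distr (distr M ?P (\<lambda>\<omega> i. \<xi> \<omega> $ i)) lborel (\<lambda>x. x i)"
      by (subst distr_distr) (auto simp: o_def intro!: measurable_PiM_single' )
    also have "\<dots> = distr (PiM UNIV (\<lambda>_::'n. N)) N (\<lambda>x. x i)"
      unfolding joint by (intro distr_cong) (auto simp: N_def)
    also have "\<dots> = N" using distr_PiM_component[of UNIV "\<lambda>_::'n. N" i] N by simp
    finally show ?thesis .
  qed
  then show "distributed M lborel (\<lambda>\<omega>. \<xi> \<omega> $ i) (normal_density 0 \<sigma>)"
    by (auto simp: distributed_def N_def)
  have "distr M (PiM UNIV (\<lambda>_::'n. borel)) (\<lambda>\<omega>. \<lambda>i\<in>UNIV. \<xi> \<omega> $ i) = distr M ?P (\<lambda>\<omega> i. \<xi> \<omega> $ i)"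
    by (intro distr_cong sets_PiM_cong) (auto simp: restrict_def)
  also have "\<dots> = PiM UNIV (\<lambda>i::'n. distr M borel (\<lambda>\<omega>. \<xi> \<omega> $ i))"
  proof -
    have "distr M borel (\<lambda>\<omega>. \<xi> \<omega> $ i) = N" for i
      unfolding marg[of i, symmetric] by (intro distr_cong) auto
    then show ?thesis unfolding joint by simp
  qed
  finally show "indep_vars (\<lambda>_. borel) (\<lambda>i \<omega>. \<xi> \<omega> $ i) UNIV"
    by (subst indep_vars_iff_distr_eq_PiM) auto
qed

text \<open>
  The density is a function of the norm, which is why it is invariant under orthogonal maps.
\<close>

lemma gaussian_density_norm:
  fixes x :: "real ^ 'n::finite"
  shows "(\<Prod>i\<in>UNIV. normal_density 0 \<sigma> (x $ i))
    = (1 / sqrt (2 * pi * \<sigma>\<^sup>2)) ^ CARD('n) * exp (- (norm x)\<^sup>2 / (2 * \<sigma>\<^sup>2))"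
proof -
  have "(norm x)\<^sup>2 = (\<Sum>i\<in>UNIV. (x $ i)\<^sup>2)"
    unfolding power2_norm_eq_inner inner_vec_def by (simp add: power2_eq_square)
  then have "exp (- (norm x)\<^sup>2 / (2 * \<sigma>\<^sup>2)) = (\<Prod>i\<in>UNIV. exp (- (x $ i)\<^sup>2 / (2 * \<sigma>\<^sup>2)))"
    by (simp add: exp_sum[symmetric] sum_divide_distrib sum_negf)
  then show ?thesis by (simp add: normal_density_def prod.distrib power_one_over prod_dividef)
qed

lemma gaussian_orthogonal:
  fixes \<xi> :: "'a \<Rightarrow> real ^ 'n::finite" and T :: "real ^ 'n \<Rightarrow> real ^ 'n"
  assumes T: "orthogonal_transformation T"
    and \<xi>: "distributed M lborel \<xi> (\<lambda>x. ennreal (\<Prod>i\<in>UNIV. normal_density 0 \<sigma> (x $ i)))"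
  shows "distributed M lborel (\<lambda>\<omega>. T (\<xi> \<omega>)) (\<lambda>x. ennreal (\<Prod>i\<in>UNIV. normal_density 0 \<sigma> (x $ i)))"
proof -
  let ?p = "\<lambda>x::real^'n. ennreal (\<Prod>i\<in>UNIV. normal_density 0 \<sigma> (x $ i))"
  have [measurable]: "T \<in> borel_measurable borel"
    using T by (intro borel_measurable_continuous_onI linear_continuous_on
        linear_conv_bounded_linear[THEN iffD1] orthogonal_transformation_linear)
  have [measurable]: "\<xi> \<in> M \<rightarrow>\<^sub>M borel" and \<xi>_distr: "distr M lborel \<xi> = density lborel ?p"
    using \<xi> by (auto simp: distributed_def)
  have p: "?p (T x) = ?p x" for x
    unfolding gaussian_density_norm orthogonal_transformation_norm[OF T] ..
  have "distr M lborel (\<lambda>\<omega>. T (\<xi> \<omega>)) = distr (distr M lborel \<xi>) lborel T"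
    by (subst distr_distr) (auto simp: o_def)
  also have "\<dots> = distr (density lborel (\<lambda>x. ?p (T x))) lborel T"
    unfolding \<xi>_distr p ..
  also have "\<dots> = density (distr lborel lborel T) ?p"
    by (subst density_distr) auto
  also have "distr lborel lborel T = lborel"
    using distr_lborel_orthogonal[OF T] by (simp cong: distr_cong)
  finally show ?thesis by (simp add: distributed_def)
qed

text \<open>
  Indexing the extended basis by the coordinate type \<open>'n\<close> makes the change of basis an orthogonal
  map of \<open>real ^ 'n\<close> to itself, so that \<open>gaussian_orthogonal\<close> applies to it.
\<close>

lemma orthonormal_extension_indexed:
  fixes e :: "'i \<Rightarrow> real ^ 'n::finite"
  assumes e: "\<And>j k. j \<in> I \<Longrightarrow> k \<in> I \<Longrightarrow> e j \<bullet> e k = (if j = k then 1 else 0)"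
  obtains f :: "'n \<Rightarrow> real ^ 'n" and h :: "'i \<Rightarrow> 'n"
  where "\<And>i j. f i \<bullet> f j = (if i = j then 1 else 0)" and "inj_on h I" and "\<And>k. k \<in> I \<Longrightarrow> f (h k) = e k"
proof -
  have orth: "pairwise real_inner_class.orthogonal (e ` I)"
    using e by (auto simp: pairwise_def real_inner_class.orthogonal_def)
  obtain U where U: "U \<inter> insert 0 (e ` I) = {}" "pairwise real_inner_class.orthogonal (e ` I \<union> U)"
      "span (e ` I \<union> U) = span (e ` I \<union> UNIV)"
    using orthogonal_extension_strong[OF orth] by blast
  have "0 \<notin> e ` I" using e by (metis imageE inner_zero_left zero_neq_one)
  then have ind: "independent (e ` I \<union> U)" using U by (intro pairwise_orthogonal_independent) auto
  moreover have "span (e ` I \<union> U) = (UNIV :: (real^'n) set)" using U(3) by simp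
  ultimately have "card (e ` I \<union> U) = CARD('n)" "finite (e ` I \<union> U)"
    using dim_eq_card_independent[OF ind] dim_span[of "e ` I \<union> U"] independent_imp_finite[OF ind] by auto
  then obtain f0 where f0: "bij_betw f0 (UNIV :: 'n set) (e ` I \<union> U)"
    by (metis finite_class.finite_UNIV finite_same_card_bij)
  define f where "f i = f0 i /\<^sub>R norm (f0 i)" for i
  define h where "h k = inv_into UNIV f0 (e k)" for k
  have f0h: "f0 (h k) = e k" if "k \<in> I" for k
    using f0 that unfolding h_def by (intro bij_betw_inv_into_right) auto
  show thesis
  proof
    fix i j
    have "f0 i \<in> e ` I \<union> U" using bij_betwE[OF f0] by simp
    moreover have "0 \<notin> e ` I \<union> U" using \<open>0 \<notin> e ` I\<close> U(1) by simp
    ultimately have "f0 i \<noteq> 0" by metis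
    moreover have "f0 i \<bullet> f0 j = 0" if "i \<noteq> j"
    proof -
      have "f0 i \<noteq> f0 j" using f0 that by (auto simp: bij_betw_def inj_on_def)
      then show ?thesis using U(2) bij_betwE[OF f0] by (auto simp: pairwise_def real_inner_class.orthogonal_def)
    qed
    ultimately show "f i \<bullet> f j = (if i = j then 1 else 0)"
      by (auto simp: f_def norm_eq_sqrt_inner field_simps)
  next
    show "inj_on h I"
    proof (rule inj_onI)
      fix j k assume jk: "j \<in> I" "k \<in> I" "h j = h k"
      then have "e j = e k" using f0h by metis
      then show "j = k" using e[OF jk(1) jk(2)] e[OF jk(2) jk(2)] by (auto split: if_splits)
    qed
  next
    fix k assume k: "k \<in> I"
    then have "norm (e k) = 1" using e[OF k k] by (simp add: norm_eq_sqrt_inner)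
    then show "f (h k) = e k" by (simp add: f_def f0h[OF k])
  qed
qed

lemma orthonormal_family_expand:
  fixes f :: "'n::finite \<Rightarrow> real ^ 'n"
  assumes f: "\<And>i j. f i \<bullet> f j = (if i = j then 1 else 0)"
  shows "orthogonal_transformation (\<lambda>x. \<chi> i. f i \<bullet> x)"
    and "x = (\<Sum>i\<in>UNIV. (f i \<bullet> x) *\<^sub>R f i)"
proof -
  define A where "A = (\<chi> i. f i)"
  have row: "Finite_Cartesian_Product.row i A = f i" for i by (simp add: A_def Finite_Cartesian_Product.row_def vec_eq_iff)
  have mult: "(\<lambda>x. A *v x) = (\<lambda>x. \<chi> i. f i \<bullet> x)"
    by (auto simp: fun_eq_iff matrix_vector_mult_def A_def inner_vec_def vec_eq_iff)
  have "orthogonal_matrix A"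
    unfolding orthogonal_matrix_orthonormal_rows row
    using f by (auto simp: norm_eq_1 real_inner_class.orthogonal_def)
  then show T: "orthogonal_transformation (\<lambda>x. \<chi> i. f i \<bullet> x)"
    using orthogonal_transformation_matrix[of "\<lambda>x. A *v x"] by (simp add: mult[symmetric])
  have "(\<chi> i. f i \<bullet> x) = (\<chi> i. f i \<bullet> (\<Sum>j\<in>UNIV. (f j \<bullet> x) *\<^sub>R f j))"
    by (simp add: vec_eq_iff inner_sum_right f if_distrib[of "\<lambda>z. _ * z"] sum.delta cong: if_cong)
  then show "x = (\<Sum>i\<in>UNIV. (f i \<bullet> x) *\<^sub>R f i)"
    using orthogonal_transformation_inj[OF T] by (auto simp: inj_on_def)
qed

text \<open>
  In an orthonormal basis that extends the \<open>e\<^sub>k\<close>, the coordinates of \<open>\<xi>\<close> are independent. The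
  projections use the coordinates along the \<open>e\<^sub>k\<close>. As \<open>g\<close> is invariant under shifts in these
  directions, \<open>g \<xi>\<close> is a function of the remaining coordinates.
\<close>

lemma gaussian_projections_law:
  fixes \<xi> :: "'a \<Rightarrow> real ^ 'n::finite" and e :: "'i \<Rightarrow> real ^ 'n" and g :: "real ^ 'n \<Rightarrow> real"
  assumes "prob_space M" and "\<sigma> > 0"
    and \<xi>: "distributed M lborel \<xi> (\<lambda>x. ennreal (\<Prod>i\<in>UNIV. normal_density 0 \<sigma> (x $ i)))"
    and I: "finite I" "I \<noteq> {}"
    and e: "\<And>j k. j \<in> I \<Longrightarrow> k \<in> I \<Longrightarrow> e j \<bullet> e k = (if j = k then 1 else 0)"
    and s: "\<And>k. k \<in> I \<Longrightarrow> s k > 0"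
    and g[measurable]: "g \<in> borel_measurable borel"
    and inv: "\<And>x k t. k \<in> I \<Longrightarrow> g (x + t *\<^sub>R e k) = g x"
  shows "distr M (PiM I (\<lambda>_. borel) \<Otimes>\<^sub>M borel) (\<lambda>\<omega>. (\<lambda>k\<in>I. m k + s k * (e k \<bullet> \<xi> \<omega>), g (\<xi> \<omega>)))
    = PiM I (\<lambda>k. density lborel (\<lambda>x. ennreal (normal_density (m k) (\<sigma> * s k) x))) \<Otimes>\<^sub>M distr M borel (\<lambda>\<omega>. g (\<xi> \<omega>))"
proof -
  interpret prob_space M by fact
  have [measurable]: "\<xi> \<in> M \<rightarrow>\<^sub>M borel" using \<xi> by (auto simp: distributed_def)
  obtain f :: "'n \<Rightarrow> real ^ 'n" and h
    where f: "\<And>i j. f i \<bullet> f j = (if i = j then 1 else 0)" and h: "inj_on h I" "\<And>k. k \<in> I \<Longrightarrow> f (h k) = e k"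
    using orthonormal_extension_indexed[OF e] by blast
  have "distributed M lborel (\<lambda>\<omega>. \<chi> i. f i \<bullet> \<xi> \<omega>) (\<lambda>x. ennreal (\<Prod>i\<in>UNIV. normal_density 0 \<sigma> (x $ i)))"
    by (rule gaussian_orthogonal[OF orthonormal_family_expand(1)[OF f] \<xi>])
  note comp = gaussian_components[OF \<open>prob_space M\<close> \<open>\<sigma> > 0\<close> this]
  have indep: "indep_vars (\<lambda>_. borel) (\<lambda>i \<omega>. f i \<bullet> \<xi> \<omega>) UNIV" using comp(1) by simp
  have normal: "distributed M lborel (\<lambda>\<omega>. f i \<bullet> \<xi> \<omega>) (normal_density 0 \<sigma>)" for i using comp(2)[of i] by simp
  \<comment> \<open>The coordinates orthogonal to all \<open>e k\<close>.\<close>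
  define J where "J = - h ` I"
  have inv_sum: "g (x + (\<Sum>k\<in>I'. t k *\<^sub>R e k)) = g x" if "finite I'" "I' \<subseteq> I" for I' x t
    using that
  proof (induction I' arbitrary: x rule: finite_induct)
    case (insert k I')
    have "g (x + (\<Sum>k\<in>insert k I'. t k *\<^sub>R e k)) = g ((x + (\<Sum>k\<in>I'. t k *\<^sub>R e k)) + t k *\<^sub>R e k)"
      using insert by (simp add: algebra_simps)
    also have "\<dots> = g (x + (\<Sum>k\<in>I'. t k *\<^sub>R e k))" using insert by (intro inv) auto
    finally show ?case using insert by simp
  qed simp
  have g_J: "g x = g (\<Sum>i\<in>J. (f i \<bullet> x) *\<^sub>R f i)" for x
  proof -
    have "x = (\<Sum>i\<in>J. (f i \<bullet> x) *\<^sub>R f i) + (\<Sum>i\<in>h ` I. (f i \<bullet> x) *\<^sub>R f i)"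
      by (subst orthonormal_family_expand(2)[OF f], subst sum.union_disjoint[symmetric])
        (auto simp: J_def intro!: sum.cong)
    also have "(\<Sum>i\<in>h ` I. (f i \<bullet> x) *\<^sub>R f i) = (\<Sum>k\<in>I. (e k \<bullet> x) *\<^sub>R e k)"
      using h by (simp add: sum.reindex)
    finally show ?thesis using inv_sum[OF I(1) order_refl] by metis
  qed
  let ?\<Lambda> = "\<lambda>\<omega>. \<lambda>k\<in>I. m k + s k * (e k \<bullet> \<xi> \<omega>)"
  let ?N = "\<lambda>k. density lborel (\<lambda>x. ennreal (normal_density (m k) (\<sigma> * s k) x))"
  let ?A = "PiM (h ` I) (\<lambda>_. borel :: real measure)" and ?J = "PiM J (\<lambda>_. borel :: real measure)"
  let ?XA = "\<lambda>\<omega>. restrict (\<lambda>i. f i \<bullet> \<xi> \<omega>) (h ` I)" and ?XJ = "\<lambda>\<omega>. restrict (\<lambda>i. f i \<bullet> \<xi> \<omega>) J"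
  have "indep_var ?A ?XA ?J ?XJ"
    by (rule indep_var_restrict[OF indep]) (auto simp: J_def)
  then have joint: "distr M ?A ?XA \<Otimes>\<^sub>M distr M ?J ?XJ = distr M (?A \<Otimes>\<^sub>M ?J) (\<lambda>\<omega>. (?XA \<omega>, ?XJ \<omega>))"
    by (simp add: indep_var_distribution_eq)
  let ?YA = "\<lambda>z. \<lambda>k\<in>I. m k + s k * z (h k)" and ?YJ = "\<lambda>z. g (\<Sum>i\<in>J. z i *\<^sub>R f i)"
  have YA: "(\<lambda>\<omega>. ?YA (?XA \<omega>)) = ?\<Lambda>" by (auto simp: fun_eq_iff h(2))
  have YJ: "(\<lambda>\<omega>. ?YJ (?XJ \<omega>)) = (\<lambda>\<omega>. g (\<xi> \<omega>))" by (auto simp: fun_eq_iff g_J[symmetric])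
  have [measurable]: "?YA \<in> ?A \<rightarrow>\<^sub>M PiM I (\<lambda>_. borel)" "?YJ \<in> ?J \<rightarrow>\<^sub>M borel" "?XA \<in> M \<rightarrow>\<^sub>M ?A" "?XJ \<in> M \<rightarrow>\<^sub>M ?J"
    by measurable
  have "distr M (PiM I (\<lambda>_. borel)) (\<lambda>\<omega>. ?YA (?XA \<omega>)) \<Otimes>\<^sub>M distr M borel (\<lambda>\<omega>. ?YJ (?XJ \<omega>))
      = distr (distr M ?A ?XA) (PiM I (\<lambda>_. borel)) ?YA \<Otimes>\<^sub>M distr (distr M ?J ?XJ) borel ?YJ"
    by (simp add: distr_distr o_def)
  also have "\<dots> = distr (distr M ?A ?XA \<Otimes>\<^sub>M distr M ?J ?XJ) (PiM I (\<lambda>_. borel) \<Otimes>\<^sub>M borel) (\<lambda>(x, y). (?YA x, ?YJ y))"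
    by (intro pair_measure_distr prob_space_imp_sigma_finite prob_space.prob_space_distr prob_space_distr) auto
  also have "\<dots> = distr M (PiM I (\<lambda>_. borel) \<Otimes>\<^sub>M borel) (\<lambda>\<omega>. (?YA (?XA \<omega>), ?YJ (?XJ \<omega>)))"
    unfolding joint by (subst distr_distr) (auto simp: o_def)
  finally have pair: "distr M (PiM I (\<lambda>_. borel) \<Otimes>\<^sub>M borel) (\<lambda>\<omega>. (?\<Lambda> \<omega>, g (\<xi> \<omega>)))
      = distr M (PiM I (\<lambda>_. borel)) ?\<Lambda> \<Otimes>\<^sub>M distr M borel (\<lambda>\<omega>. g (\<xi> \<omega>))"
    unfolding fun_cong[OF YA] fun_cong[OF YJ] by (rule sym)
  have "indep_vars (\<lambda>_. borel) (\<lambda>k \<omega>. m k + s k * (e k \<bullet> \<xi> \<omega>)) I"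
  proof -
    have "indep_vars (\<lambda>k. PiM {h k} (\<lambda>_. borel)) (\<lambda>k \<omega>. restrict (\<lambda>i. f i \<bullet> \<xi> \<omega>) {h k}) I"
      using h(1) by (intro indep_vars_restrict[OF indep]) (auto simp: disjoint_family_on_def inj_on_def)
    then have "indep_vars (\<lambda>_. borel) (\<lambda>k \<omega>. m k + s k * restrict (\<lambda>i. f i \<bullet> \<xi> \<omega>) {h k} (h k)) I"
      by (rule indep_vars_compose2) measurable
    then show ?thesis by (rule indep_vars_cong[THEN iffD1, rotated -1]) (auto simp: h(2))
  qed
  then have "distr M (PiM I (\<lambda>_. borel)) ?\<Lambda> = PiM I (\<lambda>k. distr M borel (\<lambda>\<omega>. m k + s k * (e k \<bullet> \<xi> \<omega>)))"
    using I(2) by (subst (asm) indep_vars_iff_distr_eq_PiM') auto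
  also have "\<dots> = PiM I ?N"
  proof (rule PiM_cong)
    fix k assume k: "k \<in> I"
    have "distributed M lborel (\<lambda>\<omega>. m k + s k * (f (h k) \<bullet> \<xi> \<omega>)) (normal_density (m k + s k * 0) (\<bar>s k\<bar> * \<sigma>))"
      using s[OF k] \<open>\<sigma> > 0\<close> by (intro normal_density_affine normal) auto
    then have "distr M lborel (\<lambda>\<omega>. m k + s k * (e k \<bullet> \<xi> \<omega>)) = ?N k"
      using s[OF k] by (simp add: distributed_def h(2)[OF k] mult.commute)
    moreover have "distr M borel (\<lambda>\<omega>. m k + s k * (e k \<bullet> \<xi> \<omega>)) = distr M lborel (\<lambda>\<omega>. m k + s k * (e k \<bullet> \<xi> \<omega>))"
      by (intro distr_cong) auto
    ultimately show "distr M borel (\<lambda>\<omega>. m k + s k * (e k \<bullet> \<xi> \<omega>)) = ?N k" by simp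
  qed simp
  finally show ?thesis unfolding pair by simp
qed

section \<open>A criterion for conditional distributions\<close>

text \<open>
  On the event \<open>V \<in> B\<close> the candidate is \<open>\<kappa>\<close>, and off this event the conditional
  expectation itself serves as a version. The glued function has the right integrals over the events
  of the \<open>\<sigma>\<close>-algebra of \<open>V\<close>: split such an event along \<open>V \<in> B\<close> and use the hypothesis on one part
  and the definition of conditional expectation on the other.
\<close>

lemma cond_distr_onI:
  fixes M :: "'a measure" and U :: "'a \<Rightarrow> 'b" and V :: "'a \<Rightarrow> 'c"
  assumes "prob_space M" and U[measurable]: "U \<in> M \<rightarrow>\<^sub>M S" and V[measurable]: "V \<in> M \<rightarrow>\<^sub>M T"
    and B[measurable]: "B \<in> sets T"
    and \<kappa>: "\<kappa> \<in> restrict_space T B \<rightarrow>\<^sub>M prob_algebra S"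
    and eq: "\<And>A E. A \<in> sets S \<Longrightarrow> E \<in> sets T \<Longrightarrow> E \<subseteq> B \<Longrightarrow>
      emeasure M {\<omega> \<in> space M. U \<omega> \<in> A \<and> V \<omega> \<in> E}
        = (\<integral>\<^sup>+\<omega>. indicator E (V \<omega>) * emeasure (\<kappa> (V \<omega>)) A \<partial>M)"
  shows "cond_distr_on M S U T V B \<kappa>"
  unfolding cond_distr_on_def
proof (intro conjI ballI U V B \<kappa>)
  interpret prob_space M by fact
  define F where "F = vimage_algebra (space M) V T"
  have spF: "space F = space M" by (simp add: F_def)
  have Vsp: "V \<in> space M \<rightarrow> space T" by (rule Pi_I, rule measurable_space[OF V])
  have sub: "subalgebra M F"
    using Vsp measurable_sets[OF V] by (auto simp: subalgebra_def F_def sets_vimage_algebra2)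
  interpret F: finite_measure_subalgebra M F using sub by unfold_locales
  have VF[measurable]: "V \<in> F \<rightarrow>\<^sub>M T"
    unfolding F_def using Vsp by (rule measurable_vimage_algebra1)
  fix A assume A[measurable]: "A \<in> sets S"
  define f where "f = (indicator (U -` A \<inter> space M) :: 'a \<Rightarrow> real)"
  define q where "q t = (if t \<in> B then measure (\<kappa> t) A else 0)" for t
  define g where "g \<omega> = (if V \<omega> \<in> B then q (V \<omega>) else real_cond_exp M F f \<omega>)" for \<omega>
  have Tsp: "B \<inter> space T \<in> sets T" using sets.sets_into_space[OF B] by (simp add: Int_absorb2)
  have "(\<lambda>t. measure (\<kappa> t) A) \<in> borel_measurable (restrict_space T B)"
    by (rule measurable_compose[OF \<kappa>]) simp
  then have "(\<lambda>t. indicator B t *\<^sub>R measure (\<kappa> t) A) \<in> borel_measurable T"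
    using Tsp by (subst (asm) borel_measurable_restrict_space_iff) auto
  then have q[measurable]: "q \<in> borel_measurable T"
    by (rule measurable_cong[THEN iffD1, rotated]) (simp add: q_def)
  have pr: "prob_space (\<kappa> t)" if "t \<in> B" for t
  proof -
    have "t \<in> space (restrict_space T B)" using that sets.sets_into_space[OF B] by (auto simp: space_restrict_space)
    then show ?thesis using measurable_space[OF \<kappa>] by (auto simp: space_prob_algebra)
  qed
  have q01: "0 \<le> q t" "q t \<le> 1" for t
    using pr by (auto simp: q_def prob_space.prob_le_1)
  have f[measurable]: "f \<in> borel_measurable M" unfolding f_def by measurable
  have fint: "integrable M f" by (rule integrable_const_bound[of _ 1]) (auto simp: f_def indicator_def)
  have gF: "g \<in> borel_measurable F"
    unfolding g_def by measurable
  have gM[measurable]: "g \<in> borel_measurable M" using measurable_from_subalg[OF sub gF] .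
  have ceint: "integrable M (real_cond_exp M F f)" by (rule F.real_cond_exp_int(1)[OF fint])
  have gint: "integrable M g"
  proof (rule Bochner_Integration.integrable_bound[of M "\<lambda>\<omega>. \<bar>real_cond_exp M F f \<omega>\<bar> + 1"])
    show "AE \<omega> in M. norm (g \<omega>) \<le> norm (\<bar>real_cond_exp M F f \<omega>\<bar> + 1)"
      using q01 by (auto simp: g_def intro!: AE_I2) (smt (verit))
  qed (use ceint in auto)
  have "(\<integral>\<omega>\<in>D. f \<omega> \<partial>M) = (\<integral>\<omega>\<in>D. g \<omega> \<partial>M)" if D: "D \<in> sets F" for D
  proof -
    obtain E where E[measurable]: "E \<in> sets T" and DE: "D = V -` E \<inter> space M"
      using D Vsp by (auto simp: F_def sets_vimage_algebra2)
    let ?D1 = "V -` (E \<inter> B) \<inter> space M" and ?D2 = "V -` (E - B) \<inter> space M"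
    have D12: "?D1 \<in> sets F" "?D2 \<in> sets F"
      using measurable_sets[OF VF, of "E \<inter> B"] measurable_sets[OF VF, of "E - B"] by (auto simp: spF)
    have D12M[measurable]: "?D1 \<in> sets M" "?D2 \<in> sets M" by measurable
    have split: "(\<integral>\<omega>\<in>D. u \<omega> \<partial>M) = (\<integral>\<omega>\<in>?D1. u \<omega> \<partial>M) + (\<integral>\<omega>\<in>?D2. u \<omega> \<partial>M)"
      if "integrable M u" for u :: "'a \<Rightarrow> real"
    proof -
      have "D = ?D1 \<union> ?D2" "?D1 \<inter> ?D2 = {}" by (auto simp: DE)
      then show ?thesis using that integrable_mult_indicator[OF D12M(1) that] integrable_mult_indicator[OF D12M(2) that]
        by (metis set_integral_Un set_integrable_def)
    qed
    have "(\<integral>\<omega>\<in>?D2. f \<omega> \<partial>M) = (\<integral>\<omega>\<in>?D2. real_cond_exp M F f \<omega> \<partial>M)"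
      by (rule F.real_cond_exp_intA[OF fint D12(2)])
    also have "\<dots> = (\<integral>\<omega>\<in>?D2. g \<omega> \<partial>M)"
      unfolding set_lebesgue_integral_def by (intro Bochner_Integration.integral_cong) (auto simp: g_def indicator_def)
    finally have 2: "(\<integral>\<omega>\<in>?D2. f \<omega> \<partial>M) = (\<integral>\<omega>\<in>?D2. g \<omega> \<partial>M)" .
    have "ennreal (\<integral>\<omega>\<in>?D1. f \<omega> \<partial>M) = (\<integral>\<^sup>+\<omega>. ennreal (indicator ?D1 \<omega> * f \<omega>) \<partial>M)"
      unfolding set_lebesgue_integral_def real_scaleR_def
      using integrable_mult_indicator[OF D12M(1) fint]
      by (intro nn_integral_eq_integral[symmetric]) (auto simp: f_def)
    also have "\<dots> = (\<integral>\<^sup>+\<omega>. indicator {\<omega> \<in> space M. U \<omega> \<in> A \<and> V \<omega> \<in> E \<inter> B} \<omega> \<partial>M)"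
      by (intro nn_integral_cong) (auto simp: f_def indicator_def)
    also have "\<dots> = emeasure M {\<omega> \<in> space M. U \<omega> \<in> A \<and> V \<omega> \<in> E \<inter> B}"
      by (intro nn_integral_indicator) measurable
    also have "\<dots> = (\<integral>\<^sup>+\<omega>. indicator (E \<inter> B) (V \<omega>) * emeasure (\<kappa> (V \<omega>)) A \<partial>M)"
      by (rule eq) auto
    also have "\<dots> = (\<integral>\<^sup>+\<omega>. ennreal (indicator ?D1 \<omega> * g \<omega>) \<partial>M)"
    proof (intro nn_integral_cong)
      fix \<omega> assume "\<omega> \<in> space M"
      show "indicator (E \<inter> B) (V \<omega>) * emeasure (\<kappa> (V \<omega>)) A = ennreal (indicator ?D1 \<omega> * g \<omega>)"
      proof (cases "V \<omega> \<in> E \<inter> B")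
        case True
        then interpret K: prob_space "\<kappa> (V \<omega>)" using pr by auto
        show ?thesis using True \<open>\<omega> \<in> space M\<close> by (simp add: g_def q_def K.emeasure_eq_measure)
      qed (auto simp: indicator_def)
    qed
    also have "\<dots> = ennreal (\<integral>\<omega>\<in>?D1. g \<omega> \<partial>M)"
      unfolding set_lebesgue_integral_def real_scaleR_def
      using integrable_mult_indicator[OF D12M(1) gint] q01
      by (intro nn_integral_eq_integral) (auto simp: g_def indicator_def)
    finally have "ennreal (\<integral>\<omega>\<in>?D1. f \<omega> \<partial>M) = ennreal (\<integral>\<omega>\<in>?D1. g \<omega> \<partial>M)" .
    moreover have "0 \<le> (\<integral>\<omega>\<in>?D1. f \<omega> \<partial>M)" "0 \<le> (\<integral>\<omega>\<in>?D1. g \<omega> \<partial>M)"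
      using q01 unfolding set_lebesgue_integral_def
      by (auto intro!: integral_nonneg_AE AE_I2 simp: f_def g_def indicator_def)
    ultimately show ?thesis unfolding split[OF fint] split[OF gint] 2 by simp
  qed
  then have "AE \<omega> in M. real_cond_exp M F f \<omega> = g \<omega>"
    by (intro F.real_cond_exp_charact fint gint gF)
  then show "AE \<omega> in M. V \<omega> \<in> B \<longrightarrow>
      real_cond_exp M (vimage_algebra (space M) V T) (indicator (U -` A \<inter> space M)) \<omega> = measure (\<kappa> (V \<omega>)) A"
    by eventually_elim (auto simp: F_def f_def g_def q_def)
qed

section \<open>The geometry of the active columns\<close>

definition signed_col :: "real ^ 'p::finite ^ 'n::finite \<Rightarrow> 'p + 'p \<Rightarrow> real ^ 'n" where
  "signed_col X i = (case i of Inl j \<Rightarrow> column j X | Inr j \<Rightarrow> - column j X)"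

lemma gram_entry: "(transpose X ** X) $ i $ j = column i X \<bullet> column j X"
  by (simp add: matrix_mult_transpose_dot_column)

lemma signed_gram_inner: "signed_gram X $ i $ j = signed_col X i \<bullet> signed_col X j"
  by (cases i; cases j) (simp_all add: signed_gram_def Let_def signed_col_def gram_entry)

lemma signed_vec_inner: "signed_vec (transpose X *v y) $ i = signed_col X i \<bullet> y"
  by (cases i) (simp_all add: signed_vec_def signed_col_def matrix_vector_mult_def inner_vec_def transpose_def column_def sum_negf)

text \<open>
  The linear combination of the active columns with coefficient vector \<open>M\<^sup>-\<^sup>1 f\<close>. For invertible
  \<open>M\<close> it is the vector in their span whose inner products with them are prescribed by \<open>f\<close>; this
  description replaces the matrix formulas in what follows.
\<close>

definition active_vec ::
  "real ^ 'p::finite ^ 'n::finite \<Rightarrow> ('p + 'p) list \<Rightarrow> ('p + 'p \<Rightarrow> real) \<Rightarrow> real ^ 'n" where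
  "active_vec X is f =
     (\<Sum>a<length is. vec_index (mult_mat_vec (the (mat_inverse (lars_M X is)))
        (Matrix.vec (length is) (\<lambda>a. f (is ! a)))) a *\<^sub>R signed_col X (is ! a))"

lemma mat_inverse_invertible:
  fixes A :: "'a :: field mat"
  assumes "invertible_mat A" "A \<in> carrier_mat n n"
  shows "A * the (mat_inverse A) = 1\<^sub>m n" "the (mat_inverse A) \<in> carrier_mat n n"
proof -
  obtain B where B: "A * B = 1\<^sub>m n" "B * A = 1\<^sub>m (dim_row B)"
    using assms unfolding invertible_mat_def inverts_mat_def by auto
  have "dim_col B = n" using B(1) by (metis index_mult_mat(3) index_one_mat(3))
  moreover have "dim_row B = n" using B(2) assms(2)
    by (metis carrier_matD(2) index_mult_mat(3) index_one_mat(3))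
  ultimately have "B \<in> carrier_mat n n" by auto
  then have "A \<in> Units (ring_mat TYPE('a) n ())"
    using B assms(2) by (auto simp: Units_def ring_mat_def)
  then obtain C where C: "mat_inverse A = Some C" using mat_inverse(1)[OF assms(2), of "()"] by blast
  from mat_inverse(2)[OF assms(2) this] C
  show "A * the (mat_inverse A) = 1\<^sub>m n" "the (mat_inverse A) \<in> carrier_mat n n" by auto
qed

lemma lars_M_carrier: "lars_M X is \<in> carrier_mat (length is) (length is)"
  by (simp add: lars_M_def)

lemma invertible_lars_M_Nil: "invertible_mat (lars_M X [])"
proof -
  have "lars_M X [] * lars_M X [] = 1\<^sub>m 0" by (intro eq_matI) (auto simp: lars_M_def)
  then show ?thesis unfolding invertible_mat_def inverts_mat_def
    using lars_M_carrier[of X "[]"] by (auto simp: lars_M_def)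
qed

lemma lars_proj_active_vec:
  assumes "invertible_mat (lars_M X is)"
  shows "lars_proj X is f j = signed_col X j \<bullet> active_vec X is f"
proof -
  have "dim_row (the (mat_inverse (lars_M X is))) = length is"
    using mat_inverse_invertible(2)[OF assms lars_M_carrier] by auto
  then show ?thesis
    by (simp add: lars_proj_def active_vec_def scalar_prod_def inner_sum_right signed_gram_inner
        atLeast0LessThan mult.commute)
qed

lemma active_vec_span: "active_vec X is f \<in> span (signed_col X ` set is)"
  unfolding active_vec_def by (intro span_sum span_scale span_base) auto

lemma active_vec_inner:
  assumes "invertible_mat (lars_M X is)" and "i \<in> set is"
  shows "signed_col X i \<bullet> active_vec X is f = f i"
proof -
  obtain a where a: "a < length is" "i = is ! a" using assms(2) by (auto simp: in_set_conv_nth)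
  let ?N = "the (mat_inverse (lars_M X is))"
  let ?v = "Matrix.vec (length is) (\<lambda>a. f (is ! a))"
  note N = mat_inverse_invertible[OF assms(1) lars_M_carrier]
  have dimN: "dim_row ?N = length is" using N(2) by auto
  have "signed_col X i \<bullet> active_vec X is f
      = (\<Sum>b<length is. signed_gram X $ i $ (is ! b) * vec_index (mult_mat_vec ?N ?v) b)"
    by (simp add: active_vec_def inner_sum_right signed_gram_inner mult.commute)
  also have "\<dots> = vec_index (mult_mat_vec (lars_M X is) (mult_mat_vec ?N ?v)) a"
    using a dimN by (simp add: scalar_prod_def lars_M_def atLeast0LessThan)
  also have "mult_mat_vec (lars_M X is) (mult_mat_vec ?N ?v) = mult_mat_vec (lars_M X is * ?N) ?v"
    using N(2) lars_M_carrier by (intro assoc_mult_mat_vec[symmetric]) auto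
  also have "\<dots> = ?v" using N(1) by simp
  finally show ?thesis using a by simp
qed

lemma inner_span_eq_0:
  fixes z :: "'a :: euclidean_space"
  assumes "v \<in> span S" "\<And>s. s \<in> S \<Longrightarrow> z \<bullet> s = 0"
  shows "z \<bullet> v = 0"
  by (rule orthogonal_to_span[OF assms(1), of z, unfolded real_inner_class.orthogonal_def, OF assms(2)])

lemma span_inner_eqI:
  fixes v w :: "'a :: euclidean_space"
  assumes "v \<in> span S" "w \<in> span S" "\<And>s. s \<in> S \<Longrightarrow> s \<bullet> v = s \<bullet> w"
  shows "v = w"
proof -
  have "(v - w) \<bullet> (v - w) = 0"
  proof (rule inner_span_eq_0[of _ S])
    show "v - w \<in> span S" using assms(1,2) by (rule span_diff)
    show "(v - w) \<bullet> s = 0" if "s \<in> S" for s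
      using assms(3)[OF that] inner_commute[of s v] inner_commute[of s w]
      by (simp add: inner_diff_left)
  qed
  then show ?thesis by simp
qed

lemma active_vec_eqI:
  assumes "invertible_mat (lars_M X is)" "v \<in> span (signed_col X ` set is)"
    "\<And>i. i \<in> set is \<Longrightarrow> signed_col X i \<bullet> v = f i"
  shows "active_vec X is f = v"
  using assms by (intro span_inner_eqI[OF active_vec_span]) (auto simp: active_vec_inner)

text \<open>
  The equiangular direction of LARS: the vector in the span of the active columns with the same
  correlation \<open>1\<close> with each of them.
\<close>

definition equi_vec :: "real ^ 'p::finite ^ 'n::finite \<Rightarrow> ('p + 'p) list \<Rightarrow> real ^ 'n" where
  "equi_vec X is = active_vec X is (\<lambda>_. 1)"

text \<open>The orthogonal projection of \<open>y\<close> onto the span of the active columns.\<close>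

definition active_proj ::
  "real ^ 'p::finite ^ 'n::finite \<Rightarrow> ('p + 'p) list \<Rightarrow> real ^ 'n \<Rightarrow> real ^ 'n" where
  "active_proj X is y = active_vec X is (\<lambda>i. signed_col X i \<bullet> y)"

definition resid_col ::
  "real ^ 'p::finite ^ 'n::finite \<Rightarrow> ('p + 'p) list \<Rightarrow> 'p + 'p \<Rightarrow> real ^ 'n" where
  "resid_col X is j = signed_col X j - active_proj X is (signed_col X j)"

lemma resid_orth_span:
  assumes "invertible_mat (lars_M X is)" "v \<in> span (signed_col X ` set is)"
  shows "(y - active_proj X is y) \<bullet> v = 0"
proof (rule inner_span_eq_0[OF assms(2)])
  fix s assume "s \<in> signed_col X ` set is"
  then obtain i where i: "i \<in> set is" "s = signed_col X i" by blast
  then show "(y - active_proj X is y) \<bullet> s = 0"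
    using active_vec_inner[OF assms(1) i(1), of "\<lambda>i. signed_col X i \<bullet> y"]
      inner_commute[of s y] inner_commute[of s "active_proj X is y"]
    by (simp add: active_proj_def inner_diff_left)
qed

text \<open>
  The projection is self-adjoint, so the residual can be moved from \<open>y\<close> to the column. This makes
  the numerators in the LARS ratios inner products of \<open>y\<close> with fixed vectors.
\<close>

lemma resid_col_inner:
  assumes "invertible_mat (lars_M X is)"
  shows "resid_col X is j \<bullet> y = signed_col X j \<bullet> (y - active_proj X is y)"
proof -
  have "resid_col X is j \<bullet> active_proj X is y = 0"
    using resid_orth_span[OF assms active_vec_span] by (simp add: resid_col_def active_proj_def)
  moreover have "(y - active_proj X is y) \<bullet> active_proj X is (signed_col X j) = 0"
    using resid_orth_span[OF assms active_vec_span] by (simp add: active_proj_def)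
  ultimately show ?thesis
    by (simp add: resid_col_def inner_diff_left inner_diff_right inner_commute)
qed

lemma resid_col_self:
  assumes "invertible_mat (lars_M X is)"
  shows "signed_col X j \<bullet> resid_col X is j = resid_col X is j \<bullet> resid_col X is j"
proof -
  have "resid_col X is j \<bullet> active_proj X is (signed_col X j) = 0"
    using resid_orth_span[OF assms active_vec_span] by (simp add: resid_col_def active_proj_def)
  then show ?thesis
    by (simp add: resid_col_def inner_diff_left inner_diff_right inner_commute)
qed

lemma resid_col_orth:
  assumes "invertible_mat (lars_M X is)" "i \<in> set is"
  shows "signed_col X i \<bullet> resid_col X is j = 0"
  using resid_orth_span[OF assms(1) span_base, of "signed_col X i"] assms(2)
  by (simp add: resid_col_def inner_commute)

text \<open>
  Invertibility of the larger matrix provides a vector that is orthogonal to the earlier columns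
  and has inner product \<open>1\<close> with the new one, so the new column is outside their span.
\<close>

lemma resid_col_nonzero:
  assumes "invertible_mat (lars_M X (is @ [i]))" "invertible_mat (lars_M X is)" "i \<notin> set is"
  shows "resid_col X is i \<noteq> 0"
proof
  assume "resid_col X is i = 0"
  then have "signed_col X i = active_proj X is (signed_col X i)"
    by (simp add: resid_col_def)
  then have mem: "signed_col X i \<in> span (signed_col X ` set is)"
    using active_vec_span[of X "is" "\<lambda>k. signed_col X k \<bullet> signed_col X i"]
    unfolding active_proj_def by simp
  define v where "v = active_vec X (is @ [i]) (\<lambda>k. if k = i then 1 else 0)"
  have "v \<bullet> signed_col X i = 0"
  proof (rule inner_span_eq_0[OF mem])
    fix s assume "s \<in> signed_col X ` set is"
    then obtain k where k: "k \<in> set is" "s = signed_col X k" by blast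
    then have "signed_col X k \<bullet> v = 0"
      unfolding v_def using assms(3) by (subst active_vec_inner[OF assms(1)]) auto
    then show "v \<bullet> s = 0" by (simp add: k(2) inner_commute)
  qed
  moreover have "signed_col X i \<bullet> v = 1"
    unfolding v_def by (subst active_vec_inner[OF assms(1)]) auto
  ultimately show False by (simp add: inner_commute)
qed

lemma resid_col_span:
  "resid_col X is i \<in> span (signed_col X ` set (is @ [i]))"
proof -
  have "active_proj X is (signed_col X i) \<in> span (signed_col X ` set (is @ [i]))"
    using active_vec_span[of X "is"] span_mono[of "signed_col X ` set is" "signed_col X ` set (is @ [i])"]
    unfolding active_proj_def by auto
  then show ?thesis unfolding resid_col_def by (intro span_diff) (auto intro: span_base)
qed

text \<open>
  The Gram-Schmidt step: when \<open>i\<close> enters, every active vector changes only along the residual of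
  the new column. The same direction appears in the projection and in the equiangular
  vector, and this drives \<open>ratio_crossing\<close>.
\<close>

lemma active_vec_snoc:
  assumes "invertible_mat (lars_M X (is @ [i]))" "invertible_mat (lars_M X is)" "i \<notin> set is"
  defines "w \<equiv> resid_col X is i"
  shows "active_vec X (is @ [i]) f
    = active_vec X is f + ((f i - signed_col X i \<bullet> active_vec X is f) / (w \<bullet> w)) *\<^sub>R w"
proof (rule active_vec_eqI[OF assms(1)])
  have "active_vec X is f \<in> span (signed_col X ` set (is @ [i]))"
    using active_vec_span[of X "is" f] span_mono[of "signed_col X ` set is" "signed_col X ` set (is @ [i])"]
    by auto
  then show "active_vec X is f + ((f i - signed_col X i \<bullet> active_vec X is f) / (w \<bullet> w)) *\<^sub>R w
      \<in> span (signed_col X ` set (is @ [i]))"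
    unfolding w_def by (intro span_add span_scale resid_col_span)
next
  fix k assume "k \<in> set (is @ [i])"
  have "w \<noteq> 0" unfolding w_def by (rule resid_col_nonzero[OF assms(1-3)])
  then show "signed_col X k \<bullet> (active_vec X is f + ((f i - signed_col X i \<bullet> active_vec X is f) / (w \<bullet> w)) *\<^sub>R w) = f k"
    using \<open>k \<in> set (is @ [i])\<close> resid_col_self[OF assms(2), of i]
      resid_col_orth[OF assms(2), of k i] active_vec_inner[OF assms(2), of k f]
    by (cases "k \<in> set is") (auto simp: inner_add_right w_def)
qed

section \<open>Selection and the order of the frozen knots\<close>

definition lars_ratio ::
  "real ^ 'p::finite ^ 'n::finite \<Rightarrow> ('p + 'p) list \<Rightarrow> real ^ 'n \<Rightarrow> 'p + 'p \<Rightarrow> real" where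
  "lars_ratio X is y j =
     (signed_vec (transpose X *v y) $ j - lars_Pi X is (signed_vec (transpose X *v y)) j)
       / (1 - lars_theta X is j)"

text \<open>
  The knots with the data-dependent selection replaced by a fixed tuple. Unlike the actual knots,
  the frozen ones are linear functions of \<open>y\<close>, and the frozen top is a maximum of linear functions
  over a fixed set.
\<close>

definition frozen_knot ::
  "real ^ 'p::finite ^ 'n::finite \<Rightarrow> ('p + 'p) list \<Rightarrow> real ^ 'n \<Rightarrow> nat \<Rightarrow> real" where
  "frozen_knot X is y k = lars_ratio X (take (k - 1) is) y (is ! (k - 1))"

definition frozen_top ::
  "real ^ 'p::finite ^ 'n::finite \<Rightarrow> ('p + 'p) list \<Rightarrow> real ^ 'n \<Rightarrow> real" where
  "frozen_top X is y = Max (lars_ratio X is y ` (- set is))"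

lemma lars_theta_equi_vec:
  assumes "invertible_mat (lars_M X is)"
  shows "lars_theta X is j = signed_col X j \<bullet> equi_vec X is"
  unfolding lars_theta_def equi_vec_def by (rule lars_proj_active_vec[OF assms])

lemma lars_ratio_numerator:
  assumes "invertible_mat (lars_M X is)"
  shows "lars_ratio X is y j = signed_col X j \<bullet> (y - active_proj X is y) / (1 - lars_theta X is j)"
  unfolding lars_ratio_def lars_Pi_def lars_proj_active_vec[OF assms] active_proj_def signed_vec_inner
  by (simp add: inner_diff_right)

lemma lars_ratio_resid:
  assumes "invertible_mat (lars_M X is)"
  shows "lars_ratio X is y j = resid_col X is j \<bullet> y / (1 - lars_theta X is j)"
  by (simp add: lars_ratio_numerator[OF assms] resid_col_inner[OF assms])

lemma irrepresentable_invertible: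
  assumes "irrepresentable_check X is" "k \<le> length is"
  shows "invertible_mat (lars_M X (take k is))"
  using assms invertible_lars_M_Nil by (cases "k = 0") (auto simp: irrepresentable_check_def)

text \<open>
  Active variables have \<open>\<theta> = 1\<close>, because the equiangular vector has inner product \<open>1\<close> with their
  columns. The check puts all others below \<open>1\<close>, except before the first step, where \<open>\<theta> = 0\<close>.
\<close>

lemma irrepresentable_candidates:
  assumes "irrepresentable_check X is" "k \<le> length is"
  shows "{j. lars_theta X (take k is) j < 1} = - set (take k is)"
proof (intro subset_antisym subsetI)
  note inv = irrepresentable_invertible[OF assms]
  fix j
  { assume "j \<in> {j. lars_theta X (take k is) j < 1}"
    then show "j \<in> - set (take k is)"
      using active_vec_inner[OF inv, of j "\<lambda>_. 1"] lars_theta_equi_vec[OF inv, of j]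
      by (auto simp: equi_vec_def) }
  { assume j: "j \<in> - set (take k is)"
    show "j \<in> {j. lars_theta X (take k is) j < 1}"
    proof (cases "k = 0")
      case True
      then show ?thesis using lars_theta_equi_vec[OF inv, of j] by (simp add: equi_vec_def active_vec_def)
    next
      case False
      then show ?thesis using assms j by (auto simp: irrepresentable_check_def)
    qed }
qed

lemma theta_less_1:
  assumes "irrepresentable_check X is" "k \<le> length is" "j \<notin> set (take k is)"
  shows "lars_theta X (take k is) j < 1"
  using irrepresentable_candidates[OF assms(1,2)] assms(3) by blast

lemma nth_notin_take:
  assumes "distinct is" "k < length is"
  shows "is ! k \<notin> set (take k is)"
  using assms by (auto simp: in_set_conv_nth nth_eq_iff_index_eq)

text \<open>
  Before and after \<open>i\<^sub>k\<close> enters, the vector \<open>y - P y + l u\<close> is the same if \<open>l\<close> is the \<open>k\<close>-th knot,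
  where \<open>P\<close> is the projection and \<open>u\<close> the equiangular vector: both change along the residual of the
  new column, and the knot is the value of \<open>l\<close> at which the two changes cancel. Each side of the
  identity is the inner product of this vector with the column of \<open>j\<close>, minus \<open>l\<close>.
\<close>

lemma ratio_crossing:
  fixes y :: "real ^ 'n::finite"
  assumes chk: "irrepresentable_check X is" and "distinct is" and k: "k \<in> {1..length is}"
    and j: "j \<notin> set (take k is)"
  defines "l \<equiv> frozen_knot X is y k"
  shows "(lars_ratio X (take k is) y j - l) * (1 - lars_theta X (take k is) j)
      = (lars_ratio X (take (k - 1) is) y j - l) * (1 - lars_theta X (take (k - 1) is) j)"
proof -
  define prev where "prev = take (k - 1) is"
  define i where "i = is ! (k - 1)"
  obtain k' where k': "k = Suc k'" "k' < length is" using k by (cases k) auto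
  then have cur: "take k is = prev @ [i]"
    by (simp add: prev_def i_def take_Suc_conv_app_nth)
  have inv: "invertible_mat (lars_M X (prev @ [i]))" "invertible_mat (lars_M X prev)"
    using irrepresentable_invertible[OF chk, of k] irrepresentable_invertible[OF chk, of "k - 1"] k
    unfolding cur by (auto simp: prev_def k')
  have i: "i \<notin> set prev"
    unfolding i_def prev_def using k \<open>distinct is\<close> by (intro nth_notin_take) auto
  have th: "lars_theta X (prev @ [i]) j < 1" "lars_theta X prev j < 1" "lars_theta X prev i < 1"
    using theta_less_1[OF chk, of k j] theta_less_1[OF chk, of "k - 1" j]
      theta_less_1[OF chk, of "k - 1" i] k j i unfolding cur by (auto simp: prev_def k')
  define w where "w = resid_col X prev i"
  have l: "l * (1 - signed_col X i \<bullet> equi_vec X prev) = signed_col X i \<bullet> (y - active_proj X prev y)"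
    using th(3) unfolding l_def frozen_knot_def prev_def[symmetric] i_def[symmetric]
      lars_ratio_numerator[OF inv(2)] lars_theta_equi_vec[OF inv(2)] by simp
  have proj: "active_proj X (prev @ [i]) y
      = active_proj X prev y + ((signed_col X i \<bullet> (y - active_proj X prev y)) / (w \<bullet> w)) *\<^sub>R w"
    unfolding active_proj_def active_vec_snoc[OF inv i] w_def by (simp add: inner_diff_right)
  have equi: "equi_vec X (prev @ [i])
      = equi_vec X prev + ((1 - signed_col X i \<bullet> equi_vec X prev) / (w \<bullet> w)) *\<^sub>R w"
    unfolding equi_vec_def active_vec_snoc[OF inv i] w_def by simp
  have *: "y - active_proj X (prev @ [i]) y + l *\<^sub>R equi_vec X (prev @ [i])
      = y - active_proj X prev y + l *\<^sub>R equi_vec X prev"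
    unfolding proj equi l[symmetric] by (simp add: scaleR_add_right)
  have expand: "(lars_ratio X xs y j - l) * (1 - lars_theta X xs j)
      = signed_col X j \<bullet> (y - active_proj X xs y + l *\<^sub>R equi_vec X xs) - l"
    if "invertible_mat (lars_M X xs)" "lars_theta X xs j < 1" for xs
  proof -
    have "lars_ratio X xs y j * (1 - lars_theta X xs j) = signed_col X j \<bullet> (y - active_proj X xs y)"
      using that by (simp add: lars_ratio_numerator)
    then show ?thesis
      by (simp add: lars_theta_equi_vec[OF that(1)] inner_add_right left_diff_distrib right_diff_distrib)
  qed
  show ?thesis
    unfolding cur prev_def[symmetric] expand[OF inv(1) th(1)] expand[OF inv(2) th(2)] * ..
qed

text \<open>
  The factors \<open>1 - \<theta>\<close> in \<open>ratio_crossing\<close> are positive, so comparisons of a competitor with the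
  \<open>k\<close>-th knot can be moved across the \<open>k\<close>-th step.
\<close>

lemma ratio_crossing_iff:
  assumes chk: "irrepresentable_check X is" and "distinct is" and k: "k \<in> {1..length is}"
    and j: "j \<notin> set (take k is)"
  shows "lars_ratio X (take k is) y j \<le> frozen_knot X is y k
      \<longleftrightarrow> lars_ratio X (take (k - 1) is) y j \<le> frozen_knot X is y k" (is ?le)
    and "lars_ratio X (take k is) y j < frozen_knot X is y k
      \<longleftrightarrow> lars_ratio X (take (k - 1) is) y j < frozen_knot X is y k" (is ?less)
proof -
  have "set (take (k - 1) is) \<subseteq> set (take k is)" by (intro set_take_subset_set_take) simp
  then have pos: "1 - lars_theta X (take k is) j > 0" "1 - lars_theta X (take (k - 1) is) j > 0"
    using theta_less_1[OF chk, of k j] theta_less_1[OF chk, of "k - 1" j] k j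
      diff_le_self[of k 1] by force+
  note eq = ratio_crossing[OF chk \<open>distinct is\<close> k j, of y]
  have sign: "a \<le> 0 \<longleftrightarrow> b \<le> 0" "a < 0 \<longleftrightarrow> b < 0" if "a * c = b * d" "c > 0" "d > 0" for a b c d :: real
    using that by (metis mult_le_0_iff not_less_iff_gr_or_eq order_less_le, metis mult_less_0_iff order_less_asym)
  show ?le ?less using sign[OF eq pos] by simp_all
qed

lemma lars_pathD:
  assumes "lars_path X y N lam ih" "k \<in> {1..N}"
  defines "g \<equiv> lars_ratio X (map ih [1..<k]) y" and "C \<equiv> {j. lars_theta X (map ih [1..<k]) j < 1}"
  shows "lam k = g (ih k)" "lam k = Max (g ` C)" "ih k \<in> C" "\<And>j. j \<in> C \<Longrightarrow> g j \<le> g (ih k)"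
proof -
  have g: "g = (\<lambda>j. (signed_vec (transpose X *v y) $ j
      - lars_Pi X (map ih [1..<k]) (signed_vec (transpose X *v y)) j) / (1 - lars_theta X (map ih [1..<k]) j))"
    unfolding g_def lars_ratio_def by (rule refl)
  have 1: "lam k = Max (g ` C) \<and> is_arg_max g (\<lambda>j. j \<in> C) (ih k)"
    using assms(1,2) unfolding lars_path_def Let_def g C_def by blast
  then show max: "lam k = Max (g ` C)" "ih k \<in> C" "\<And>j. j \<in> C \<Longrightarrow> g j \<le> g (ih k)"
    unfolding is_arg_max_def by (auto simp: not_less)
  show "lam k = g (ih k)"
    unfolding max(1) by (rule Max_eqI) (use max(2,3) in auto)
qed

lemma take_selected:
  assumes "map ih [1..<K + 1] = is" "k \<in> {1..K + 1}"
  shows "map ih [1..<k] = take (k - 1) is"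
proof -
  have "take (k - 1) [1..<K + 1] = [1..<1 + (k - 1)]" using assms(2) by (intro take_upt) auto
  then show ?thesis using assms by (auto simp: take_map simp del: upt_Suc)
qed

lemma selected_nth:
  assumes "map ih [1..<K + 1] = is" "k \<in> {1..K}"
  shows "ih k = is ! (k - 1)"
  using assms by (auto simp del: upt_Suc)

text \<open>
  For a selected tuple the frozen knots are the actual ones. They decrease because the variable
  selected at step \<open>k + 1\<close> was already a candidate at step \<open>k\<close>: its ratio was at most the \<open>k\<close>-th knot
  then, and stays so after the step.
\<close>

lemma selected_imp_ordered:
  assumes path: "lars_path X y (K + 1) lam ih" and sel: "map ih [1..<K + 1] = is"
    and chk: "irrepresentable_check X is" and dist: "distinct is" and "1 \<le> K"
  shows "\<And>k. k \<in> {1..K} \<Longrightarrow> lam k = frozen_knot X is y k"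
    and "lam (K + 1) = frozen_top X is y"
    and "\<And>k. k \<in> {1..<K} \<Longrightarrow> frozen_knot X is y (k + 1) \<le> frozen_knot X is y k"
    and "frozen_top X is y \<le> frozen_knot X is y K"
proof -
  have len: "length is = K" using sel by auto
  note before = take_selected[OF sel]
  show lam: "lam k = frozen_knot X is y k" if "k \<in> {1..K}" for k
    using lars_pathD(1)[OF path, of k] that before[of k] selected_nth[OF sel that]
    by (simp add: frozen_knot_def)
  show top: "lam (K + 1) = frozen_top X is y"
    using lars_pathD(2)[OF path, of "K + 1"] before[of "K + 1"] len
      irrepresentable_candidates[OF chk, of K] by (simp add: frozen_top_def)
  have dec: "lam (k + 1) \<le> lam k" if k: "k \<in> {1..K}" for k
  proof -
    have k': "k + 1 \<in> {1..K + 1}" "k \<in> {1..K + 1}" "k \<in> {1..length is}" using k len by auto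
    have mem: "ih (k + 1) \<notin> set (take k is)"
      using lars_pathD(3)[OF path k'(1)] before[OF k'(1)] irrepresentable_candidates[OF chk, of k] k len
      by auto
    moreover have "set (take (k - 1) is) \<subseteq> set (take k is)" by (intro set_take_subset_set_take) simp
    moreover have "k - 1 \<le> length is" using k len by auto
    ultimately have "lars_ratio X (take (k - 1) is) y (ih (k + 1)) \<le> lam k"
      using lars_pathD(4)[OF path k'(2), of "ih (k + 1)"] lars_pathD(1)[OF path k'(2)]
        irrepresentable_candidates[OF chk, of "k - 1"] k len before[OF k'(2)] by auto
    then have "lars_ratio X (take k is) y (ih (k + 1)) \<le> lam k"
      unfolding lam[OF k] ratio_crossing_iff(1)[OF chk dist k'(3) mem] .
    then show ?thesis using lars_pathD(1)[OF path k'(1)] before[OF k'(1)] by simp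
  qed
  show "frozen_knot X is y (k + 1) \<le> frozen_knot X is y k" if "k \<in> {1..<K}" for k
    using dec[of k] that lam[of k] lam[of "k + 1"] by auto
  show "frozen_top X is y \<le> frozen_knot X is y K"
    using dec[of K] lam[of K] top \<open>1 \<le> K\<close> by auto
qed

text \<open>
  Backward induction on \<open>k\<close>. Competitors at step \<open>k + 1\<close> are below knot \<open>k + 1\<close>, hence below
  knot \<open>k\<close>, and so is \<open>i\<^bsub>k+1\<^esub>\<close>, whose ratio is knot \<open>k + 1\<close>. Moving these
  comparisons across step \<open>k\<close> gives the claim there. The frozen top starts the induction.
\<close>

lemma ordered_imp_argmax:
  assumes chk: "irrepresentable_check X is" and dist: "distinct is" and len: "length is = K"
    and dec: "\<And>k. k \<in> {1..<K} \<Longrightarrow> frozen_knot X is y (k + 1) < frozen_knot X is y k"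
    and top: "frozen_top X is y < frozen_knot X is y K"
    and k: "k \<in> {1..K}" and j: "j \<notin> set (take k is)"
  shows "lars_ratio X (take (k - 1) is) y j < frozen_knot X is y k"
proof -
  have "k \<le> K" using k by simp
  then show ?thesis using k j
  proof (induction k arbitrary: j rule: inc_induct)
    case base
    have "lars_ratio X (take K is) y j \<le> frozen_top X is y"
      unfolding frozen_top_def using base len by (intro Max_ge) auto
    with top have "lars_ratio X (take K is) y j < frozen_knot X is y K" by simp
    then show ?case using ratio_crossing_iff(2)[OF chk dist, of K j y] base len by auto
  next
    case (step k)
    have "lars_ratio X (take k is) y j < frozen_knot X is y k"
    proof (cases "j = is ! k")
      case True
      then show ?thesis using dec[of k] step by (simp add: frozen_knot_def)
    next
      case False
      then have "j \<notin> set (take (Suc k) is)"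
        using step len by (auto simp: take_Suc_conv_app_nth)
      then show ?thesis using step.IH[of j] dec[of k] step by force
    qed
    then show ?case using ratio_crossing_iff(2)[OF chk dist, of k j y] step len by auto
  qed
qed

text \<open>
  By \<open>ordered_imp_argmax\<close> each \<open>i\<^sub>k\<close> is the strict maximizer over the candidates, so the path has
  to follow the tuple, whatever its rule for ties.
\<close>

lemma ordered_imp_selected:
  assumes path: "lars_path X y (K + 1) lam ih"
    and chk: "irrepresentable_check X is" and dist: "distinct is" and len: "length is = K"
    and dec: "\<And>k. k \<in> {1..<K} \<Longrightarrow> frozen_knot X is y (k + 1) < frozen_knot X is y k"
    and top: "frozen_top X is y < frozen_knot X is y K"
  shows "map ih [1..<K + 1] = is"
proof -
  have "map ih [1..<k + 1] = take k is" if "k \<le> K" for k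
    using that
  proof (induction k)
    case (Suc k)
    then have sel: "map ih [1..<Suc k] = take k is" and k: "Suc k \<in> {1..K + 1}" by auto
    have C: "{j. lars_theta X (map ih [1..<Suc k]) j < 1} = - set (take k is)"
      unfolding sel using irrepresentable_candidates[OF chk, of k] Suc.prems len by simp
    have "ih (Suc k) = is ! k"
    proof (rule ccontr)
      assume ne: "ih (Suc k) \<noteq> is ! k"
      have "ih (Suc k) \<notin> set (take k is)" using lars_pathD(3)[OF path k] C by blast
      then have "ih (Suc k) \<notin> set (take (Suc k) is)"
        using ne Suc.prems len by (auto simp: take_Suc_conv_app_nth)
      from ordered_imp_argmax[OF chk dist len dec top _ this, of] Suc.prems
      have "lars_ratio X (take k is) y (ih (Suc k)) < lars_ratio X (take k is) y (is ! k)"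
        by (simp add: frozen_knot_def)
      moreover have "is ! k \<notin> set (take k is)"
        using Suc.prems len dist by (intro nth_notin_take) auto
      then have "is ! k \<in> {j. lars_theta X (map ih [1..<Suc k]) j < 1}" unfolding C by simp
      from lars_pathD(4)[OF path k this]
      have "lars_ratio X (take k is) y (is ! k) \<le> lars_ratio X (take k is) y (ih (Suc k))"
        unfolding sel .
      ultimately show False by simp
    qed
    then show ?case using sel Suc.prems len by (simp add: take_Suc_conv_app_nth)
  qed simp
  from this[of K] len show ?thesis by simp
qed

section \<open>Frozen knots as orthogonal linear functionals\<close>

definition knot_dir :: "real ^ 'p::finite ^ 'n::finite \<Rightarrow> ('p + 'p) list \<Rightarrow> nat \<Rightarrow> real ^ 'n" where
  "knot_dir X is k = resid_col X (take (k - 1) is) (is ! (k - 1))"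

definition knot_gap :: "real ^ 'p::finite ^ 'n::finite \<Rightarrow> ('p + 'p) list \<Rightarrow> nat \<Rightarrow> real" where
  "knot_gap X is k = 1 - lars_theta X (take (k - 1) is) (is ! (k - 1))"

definition regular_tuple :: "real ^ 'p::finite ^ 'n::finite \<Rightarrow> ('p + 'p) list \<Rightarrow> bool" where
  "regular_tuple X is \<longleftrightarrow> irrepresentable_check X is \<and> distinct (map signed_var is) \<and> is \<noteq> []"

lemma regular_tuple_distinct: "regular_tuple X is \<Longrightarrow> distinct is"
  by (simp add: regular_tuple_def distinct_map)

text \<open>
  The opposite sign of an active variable is never active, so the maximum that defines the frozen
  top ranges over a nonempty set.
\<close>

lemma opposite_sign_inactive:
  assumes "distinct (map signed_var is)" "is \<noteq> []"
  shows "- set is \<noteq> {}"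
proof -
  define i where "i = is ! 0"
  define i' where "i' = (case i of Inl j \<Rightarrow> Inr j | Inr j \<Rightarrow> Inl j)"
  have "signed_var i' = signed_var i" "i' \<noteq> i"
    by (auto simp: i'_def signed_var_def split: sum.split)
  moreover have "i \<in> set is" using assms(2) by (simp add: i_def)
  ultimately have "i' \<notin> set is" using assms(1) by (metis distinct_map inj_on_def)
  then show ?thesis by blast
qed

lemma regular_prefix:
  assumes "regular_tuple X is" "k \<in> {1..length is}"
  shows "invertible_mat (lars_M X (take (k - 1) is))" "invertible_mat (lars_M X (take k is))"
    "is ! (k - 1) \<notin> set (take (k - 1) is)" "take k is = take (k - 1) is @ [is ! (k - 1)]"
proof -
  obtain k' where k': "k = Suc k'" "k' < length is" using assms(2) by (cases k) auto
  show "invertible_mat (lars_M X (take (k - 1) is))" "invertible_mat (lars_M X (take k is))"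
    using assms k' by (auto simp: regular_tuple_def intro!: irrepresentable_invertible)
  show "is ! (k - 1) \<notin> set (take (k - 1) is)"
    using regular_tuple_distinct[OF assms(1)] k' by (auto dest: nth_notin_take)
  show "take k is = take (k - 1) is @ [is ! (k - 1)]"
    using k' by (simp add: take_Suc_conv_app_nth)
qed

lemma knot_gap_pos:
  assumes "regular_tuple X is" "k \<in> {1..length is}"
  shows "knot_gap X is k > 0"
  using theta_less_1[of X "is" "k - 1" "is ! (k - 1)"] regular_prefix(3)[OF assms] assms
  by (auto simp: knot_gap_def regular_tuple_def intro: le_trans[OF diff_le_self])

lemma knot_dir_nonzero:
  assumes "regular_tuple X is" "k \<in> {1..length is}"
  shows "knot_dir X is k \<noteq> 0"
  unfolding knot_dir_def using regular_prefix[OF assms] by (intro resid_col_nonzero) auto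

lemma knot_dir_span:
  assumes "regular_tuple X is" "k \<in> {1..length is}" "k \<le> m"
  shows "knot_dir X is k \<in> span (signed_col X ` set (take m is))"
proof -
  have "knot_dir X is k \<in> span (signed_col X ` set (take k is))"
    unfolding knot_dir_def regular_prefix(4)[OF assms(1,2)] by (rule resid_col_span)
  moreover have "span (signed_col X ` set (take k is)) \<subseteq> span (signed_col X ` set (take m is))"
    using assms(3) by (intro span_mono image_mono set_take_subset_set_take)
  ultimately show ?thesis by blast
qed

lemma resid_knot_dir_orth:
  assumes "regular_tuple X is" "k \<in> {1..length is}" "k \<le> m" "m \<le> length is"
  shows "resid_col X (take m is) j \<bullet> knot_dir X is k = 0"
proof (rule inner_span_eq_0[OF knot_dir_span[OF assms(1-3)]])
  fix s assume "s \<in> signed_col X ` set (take m is)"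
  then obtain i where i: "i \<in> set (take m is)" "s = signed_col X i" by blast
  have "invertible_mat (lars_M X (take m is))"
    using assms by (intro irrepresentable_invertible) (auto simp: regular_tuple_def)
  from resid_col_orth[OF this i(1)] show "resid_col X (take m is) j \<bullet> s = 0"
    by (simp add: i(2) inner_commute)
qed

lemma knot_dir_orth:
  assumes "regular_tuple X is" "j \<in> {1..length is}" "k \<in> {1..length is}" "j \<noteq> k"
  shows "knot_dir X is j \<bullet> knot_dir X is k = 0"
proof -
  have *: "knot_dir X is k \<bullet> knot_dir X is j = 0"
    if "j < k" "j \<in> {1..length is}" "k \<in> {1..length is}" for j k
    unfolding knot_dir_def[of X "is" k] using that assms(1)
    by (intro resid_knot_dir_orth) auto
  show ?thesis
    using assms *[of j k] *[of k j] by (cases "j < k") (auto simp: inner_commute)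
qed

lemma frozen_knot_dir:
  assumes "regular_tuple X is" "k \<in> {1..length is}"
  shows "frozen_knot X is y k = knot_dir X is k \<bullet> y / knot_gap X is k"
  unfolding frozen_knot_def lars_ratio_resid[OF regular_prefix(1)[OF assms]] knot_dir_def knot_gap_def ..

text \<open>
  The mean is the frozen knot at the noiseless response.
\<close>

lemma lars_mean_knot: "lars_mean X \<beta> is k = frozen_knot X is (X *v \<beta>) k"
  unfolding lars_mean_def frozen_knot_def lars_ratio_def lars_Pi_def Let_def
  by (simp only: matrix_vector_mul_assoc)

text \<open>
  The Schur complement under the square root is the squared norm of the residual column.
\<close>

lemma lars_scale_knot:
  assumes "regular_tuple X is" "k \<in> {1..length is}"
  shows "lars_scale X is k = norm (knot_dir X is k) / knot_gap X is k"
proof -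
  note inv = regular_prefix(1)[OF assms]
  define i where "i = is ! (k - 1)"
  define prev where "prev = take (k - 1) is"
  have "signed_gram X $ i $ i - lars_proj X prev (\<lambda>i'. signed_gram X $ i $ i') i
      = signed_col X i \<bullet> resid_col X prev i"
    unfolding signed_gram_inner lars_proj_active_vec[OF inv[folded prev_def]] resid_col_def active_proj_def
    by (simp add: inner_diff_right inner_commute)
  also have "\<dots> = (norm (resid_col X prev i))\<^sup>2"
    using resid_col_self[OF inv] by (simp add: prev_def power2_norm_eq_inner)
  finally show ?thesis
    unfolding lars_scale_def Let_def knot_dir_def knot_gap_def i_def[symmetric] prev_def[symmetric] by simp
qed

lemma lars_scale_pos:
  assumes "regular_tuple X is" "k \<in> {1..length is}"
  shows "lars_scale X is k > 0"
  using knot_dir_nonzero[OF assms] knot_gap_pos[OF assms] by (simp add: lars_scale_knot[OF assms])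

text \<open>
  The residual columns that enter the frozen top are orthogonal to the span of the active columns,
  which contains all knot directions. This is the source of the independence of \<open>\<lambda>\<^bsub>K+1\<^esub>\<close>.
\<close>

lemma frozen_top_shift:
  assumes "regular_tuple X is" "k \<in> {1..length is}"
  shows "frozen_top X is (y + t *\<^sub>R knot_dir X is k) = frozen_top X is y"
proof -
  have inv: "invertible_mat (lars_M X is)"
    using regular_prefix(2)[OF assms(1), of "length is"] assms by auto
  have "resid_col X is j \<bullet> knot_dir X is k = 0" for j
    using resid_knot_dir_orth[OF assms, of "length is" j] assms(2) by simp
  then show ?thesis
    by (simp add: frozen_top_def lars_ratio_resid[OF inv] inner_add_right)
qed

lemma frozen_top_measurable:
  assumes "regular_tuple X is"
  shows "frozen_top X is \<in> borel_measurable borel"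
proof -
  have inv: "invertible_mat (lars_M X is)"
    using regular_prefix(2)[OF assms(1), of "length is"] assms by (auto simp: regular_tuple_def Suc_le_eq)
  show ?thesis
    unfolding frozen_top_def lars_ratio_resid[OF inv]
    by (intro borel_measurable_Max borel_measurable_divide borel_measurable_inner) auto
qed

lemma AE_hyperplane:
  fixes \<eta> :: "'a \<Rightarrow> 'b::euclidean_space"
  assumes "distributed M lborel \<eta> p" "a \<noteq> 0"
  shows "AE \<omega> in M. a \<bullet> (v + \<eta> \<omega>) \<noteq> 0"
proof -
  have [measurable]: "\<eta> \<in> M \<rightarrow>\<^sub>M borel" "p \<in> borel_measurable borel" and d: "distr M lborel \<eta> = density lborel p"
    using assms(1) by (auto simp: distributed_def)
  have "{x. a \<bullet> (v + x) = 0} = {x. a \<bullet> x = - (a \<bullet> v)}"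
    by (auto simp: inner_add_right)
  moreover have "negligible {x. a \<bullet> x = - (a \<bullet> v)}"
    using assms(2) by (intro negligible_hyperplane) simp
  ultimately have "{x. a \<bullet> (v + x) = 0} \<in> null_sets lebesgue"
    by (simp add: negligible_iff_null_sets)
  moreover have "{x. a \<bullet> (v + x) = 0} \<in> sets borel" by measurable
  ultimately have "{x. a \<bullet> (v + x) = 0} \<in> null_sets lborel"
    by (simp add: null_sets_completion_iff)
  then have "AE x in lborel. a \<bullet> (v + x) \<noteq> 0"
    by (intro AE_I'[of "{x. a \<bullet> (v + x) = 0}"]) auto
  then have "AE x in density lborel p. a \<bullet> (v + x) \<noteq> 0"
    by (subst AE_density) auto
  then show ?thesis unfolding d[symmetric] by (subst (asm) AE_distr_iff) auto
qed

definition knot_order :: "nat \<Rightarrow> real \<Rightarrow> (nat \<Rightarrow> real) set" where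
  "knot_order K x = {l. (\<forall>k\<in>{1..<K}. l k \<ge> l (k + 1)) \<and> l K \<ge> x}"

text \<open>
  The two implications between selection and order differ only by ties. A tie of knot \<open>k\<close> with the
  next knot, or with a competitor for the frozen top, says that \<open>Y\<close> is orthogonal to
  \<open>w\<^sub>k / d\<^sub>k - w\<close> with \<open>w\<close> orthogonal to \<open>w\<^sub>k\<close>. This vector is nonzero because of its component
  along \<open>w\<^sub>k\<close>.
\<close>

lemma AE_selected_iff_ordered:
  assumes reg: "regular_tuple X is" and len: "length is = K"
    and \<eta>: "distributed M lborel \<eta> p"
    and Y: "\<And>\<omega>. \<omega> \<in> space M \<Longrightarrow> Y \<omega> = v + \<eta> \<omega>"
    and path: "\<And>\<omega>. \<omega> \<in> space M \<Longrightarrow> lars_path X (Y \<omega>) (K + 1) (\<lambda>k. lam k \<omega>) (\<lambda>k. ih k \<omega>)"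
  shows "AE \<omega> in M. map (\<lambda>k. ih k \<omega>) [1..<K + 1] = is \<longleftrightarrow>
    frozen_knot X is (Y \<omega>) \<in> knot_order K (frozen_top X is (Y \<omega>))"
proof -
  have chk: "irrepresentable_check X is" and dist: "distinct is" and K1: "1 \<le> K"
    using reg len regular_tuple_distinct by (auto simp: regular_tuple_def Suc_le_eq)
  have inv: "invertible_mat (lars_M X is)"
    using regular_prefix(2)[OF reg, of "length is"] K1 len by simp
  have tie: "AE \<omega> in M. a \<bullet> (v + \<eta> \<omega>) \<noteq> 0"
    if k: "k \<in> {1..K}" and a: "a = knot_dir X is k /\<^sub>R knot_gap X is k - w" and w: "w \<bullet> knot_dir X is k = 0" for k a w
  proof (rule AE_hyperplane[OF \<eta>])
    have "a \<bullet> knot_dir X is k = (knot_dir X is k \<bullet> knot_dir X is k) / knot_gap X is k"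
      unfolding a using w by (simp add: inner_diff_left divide_inverse mult.commute)
    also have "\<dots> \<noteq> 0"
      using knot_dir_nonzero[OF reg, of k] knot_gap_pos[OF reg, of k] k len by auto
    finally show "a \<noteq> 0" by auto
  qed
  have "AE \<omega> in M. \<forall>k\<in>{1..<K}. frozen_knot X is (v + \<eta> \<omega>) k \<noteq> frozen_knot X is (v + \<eta> \<omega>) (k + 1)"
  proof (rule AE_finite_allI)
    fix k assume k: "k \<in> {1..<K}"
    then have k': "k \<in> {1..length is}" "k + 1 \<in> {1..length is}" using len by auto
    have "AE \<omega> in M. (knot_dir X is k /\<^sub>R knot_gap X is k - knot_dir X is (k + 1) /\<^sub>R knot_gap X is (k + 1)) \<bullet> (v + \<eta> \<omega>) \<noteq> 0"
      using k knot_dir_orth[OF reg k'(2,1)] by (intro tie[OF _ refl]) auto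
    then show "AE \<omega> in M. frozen_knot X is (v + \<eta> \<omega>) k \<noteq> frozen_knot X is (v + \<eta> \<omega>) (k + 1)"
      unfolding frozen_knot_dir[OF reg k'(1)] frozen_knot_dir[OF reg k'(2)]
      by eventually_elim (simp add: inner_diff_left divide_inverse mult.commute)
  qed simp
  moreover have "AE \<omega> in M. \<forall>j\<in>- set is. frozen_knot X is (v + \<eta> \<omega>) K \<noteq> lars_ratio X is (v + \<eta> \<omega>) j"
  proof (rule AE_finite_allI)
    fix j
    have KK: "K \<in> {1..length is}" using K1 len by simp
    have "AE \<omega> in M. (knot_dir X is K /\<^sub>R knot_gap X is K - resid_col X is j /\<^sub>R (1 - lars_theta X is j)) \<bullet> (v + \<eta> \<omega>) \<noteq> 0"
      using K1 resid_knot_dir_orth[OF reg KK, of K j] len by (intro tie[OF _ refl]) auto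
    then show "AE \<omega> in M. frozen_knot X is (v + \<eta> \<omega>) K \<noteq> lars_ratio X is (v + \<eta> \<omega>) j"
      unfolding frozen_knot_dir[OF reg KK] lars_ratio_resid[OF inv]
      by eventually_elim (simp add: inner_diff_left divide_inverse mult.commute)
  qed simp
  ultimately show ?thesis
    using AE_space
  proof eventually_elim
    case (elim \<omega>)
    let ?y = "Y \<omega>"
    have y: "v + \<eta> \<omega> = ?y" using Y elim(3) by simp
    note p = path[OF elim(3)]
    show ?case
    proof
      assume sel: "map (\<lambda>k. ih k \<omega>) [1..<K + 1] = is"
      show "frozen_knot X is ?y \<in> knot_order K (frozen_top X is ?y)"
        using selected_imp_ordered(3,4)[OF p sel chk dist K1] by (auto simp: knot_order_def)
    next
      assume ord: "frozen_knot X is ?y \<in> knot_order K (frozen_top X is ?y)"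
      have "frozen_top X is ?y \<in> lars_ratio X is ?y ` (- set is)"
        unfolding frozen_top_def
      proof (rule Max_in)
        show "lars_ratio X is ?y ` (- set is) \<noteq> {}"
          using opposite_sign_inactive[of "is"] reg by (simp add: regular_tuple_def)
      qed simp
      then have "frozen_top X is ?y \<noteq> frozen_knot X is ?y K" using elim(2) unfolding y by force
      then have top: "frozen_top X is ?y < frozen_knot X is ?y K" using ord by (simp add: knot_order_def)
      have dec: "frozen_knot X is ?y (k + 1) < frozen_knot X is ?y k" if "k \<in> {1..<K}" for k
      proof -
        have "frozen_knot X is ?y k \<noteq> frozen_knot X is ?y (k + 1)" using elim(1) that unfolding y by blast
        moreover have "frozen_knot X is ?y (k + 1) \<le> frozen_knot X is ?y k"
          using ord that by (simp add: knot_order_def)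
        ultimately show ?thesis by simp
      qed
      show "map (\<lambda>k. ih k \<omega>) [1..<K + 1] = is"
        by (rule ordered_imp_selected[OF p chk dist len dec top])
    qed
  qed
qed

section \<open>The truncated product density\<close>

lemma normalized_density:
  fixes w :: "'b \<Rightarrow> real"
  assumes w[measurable]: "w \<in> borel_measurable S" and pos: "\<And>l. 0 \<le> w l"
    and W: "(\<integral>\<^sup>+l. ennreal (w l) \<partial>S) \<noteq> 0" "(\<integral>\<^sup>+l. ennreal (w l) \<partial>S) \<noteq> \<infinity>"
  defines "N \<equiv> density S (\<lambda>l. ennreal (inverse (LINT l|S. w l) * w l))"
  shows "prob_space N"
    and "A \<in> sets S \<Longrightarrow> emeasure N A * (\<integral>\<^sup>+l. ennreal (w l) \<partial>S) = (\<integral>\<^sup>+l. ennreal (w l) * indicator A l \<partial>S)"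
proof -
  define Q where "Q = (LINT l|S. w l)"
  have Qw: "(\<integral>\<^sup>+l. ennreal (w l) \<partial>S) = ennreal Q"
  proof -
    have "integrable S w" using W(2) pos by (intro integrableI_nonneg) (auto simp: top.not_eq_extremum)
    then show ?thesis unfolding Q_def using pos by (intro nn_integral_eq_integral) auto
  qed
  have Q: "Q > 0" using W(1) unfolding Qw by (simp add: ennreal_eq_0_iff not_le)
  have em: "emeasure N A = ennreal (inverse Q) * (\<integral>\<^sup>+l. ennreal (w l) * indicator A l \<partial>S)" if "A \<in> sets S" for A
  proof -
    have "emeasure N A = (\<integral>\<^sup>+l. ennreal (inverse Q * w l) * indicator A l \<partial>S)"
      unfolding N_def Q_def[symmetric] using that by (intro emeasure_density) auto
    also have "\<dots> = (\<integral>\<^sup>+l. ennreal (inverse Q) * (ennreal (w l) * indicator A l) \<partial>S)"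
      using Q pos by (intro nn_integral_cong) (simp add: ennreal_mult mult.assoc)
    also have "\<dots> = ennreal (inverse Q) * (\<integral>\<^sup>+l. ennreal (w l) * indicator A l \<partial>S)"
      using that by (intro nn_integral_cmult) auto
    finally show ?thesis .
  qed
  have cancel: "ennreal (inverse Q) * ennreal Q = 1"
    using Q by (simp add: ennreal_mult[symmetric])
  show "emeasure N A * (\<integral>\<^sup>+l. ennreal (w l) \<partial>S) = (\<integral>\<^sup>+l. ennreal (w l) * indicator A l \<partial>S)" if "A \<in> sets S"
  proof -
    have "emeasure N A * ennreal Q = (ennreal (inverse Q) * ennreal Q) * (\<integral>\<^sup>+l. ennreal (w l) * indicator A l \<partial>S)"
      unfolding em[OF that] by (simp only: mult.assoc mult.commute mult.left_commute)
    then show ?thesis unfolding Qw cancel by simp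
  qed
  have "emeasure N (space N) = ennreal (inverse Q) * (\<integral>\<^sup>+l. ennreal (w l) * indicator (space S) l \<partial>S)"
    using em[of "space S"] by (simp add: N_def)
  also have "(\<integral>\<^sup>+l. ennreal (w l) * indicator (space S) l \<partial>S) = ennreal Q"
    unfolding Qw[symmetric] by (intro nn_integral_cong) simp
  finally show "prob_space N" using cancel by (intro prob_spaceI) simp
qed

text \<open>
  The box with sides \<open>[x + K - k, x + K - k + 1]\<close> consists of decreasing sequences above \<open>x\<close>:
  consecutive sides share only an endpoint.
\<close>

lemma knot_order_not_null:
  assumes "1 \<le> K"
    and meas: "knot_order K x \<inter> space (PiM {1..K} (\<lambda>_. lborel)) \<in> sets (PiM {1..K} (\<lambda>_. lborel))"
  shows "emeasure (PiM {1..K} (\<lambda>_. lborel)) (knot_order K x \<inter> space (PiM {1..K} (\<lambda>_. lborel))) \<noteq> 0"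
proof
  assume null: "emeasure (PiM {1..K} (\<lambda>_. lborel)) (knot_order K x \<inter> space (PiM {1..K} (\<lambda>_. lborel))) = 0"
  interpret product_sigma_finite "\<lambda>_::nat. lborel :: real measure" ..
  define D where "D = (\<Pi>\<^sub>E k\<in>{1..K}. {x + real (K - k)..x + real (K - k) + 1})"
  have "D \<subseteq> knot_order K x \<inter> space (PiM {1..K} (\<lambda>_. lborel))"
  proof
    fix l assume l: "l \<in> D"
    have b: "x + real (K - k) \<le> l k" "l k \<le> x + real (K - k) + 1" if "k \<in> {1..K}" for k
      using l that by (auto simp: D_def PiE_def Pi_def)
    have "l (k + 1) \<le> l k" if "k \<in> {1..<K}" for k
      using b(2)[of "k + 1"] b(1)[of k] that by (auto simp: of_nat_diff)
    then show "l \<in> knot_order K x \<inter> space (PiM {1..K} (\<lambda>_. lborel))"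
      using b(1)[of K] l \<open>1 \<le> K\<close> by (auto simp: knot_order_def space_PiM D_def PiE_def)
  qed
  then have "emeasure (PiM {1..K} (\<lambda>_. lborel)) D \<le> 0"
    using emeasure_mono[OF _ meas, of D] null by simp
  moreover have "emeasure (PiM {1..K} (\<lambda>_. lborel)) D = 1"
    unfolding D_def by (subst emeasure_PiM) auto
  ultimately show False by simp
qed

lemma knot_order_measurable:
  fixes K :: nat
  defines "S \<equiv> PiM {1..K} (\<lambda>_. lborel :: real measure) \<Otimes>\<^sub>M (borel :: real measure)"
  assumes "1 \<le> K"
  shows "{z \<in> space S. fst z \<in> knot_order K (snd z)} \<in> sets S"
proof -
  have coord[measurable]: "(\<lambda>z. fst z k) \<in> borel_measurable S" if "k \<in> {1..K}" for k
    unfolding S_def by (rule measurable_compose[OF measurable_fst]) (use that in measurable)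
  have last[measurable]: "snd \<in> borel_measurable S" unfolding S_def by measurable
  have 1: "{z \<in> space S. fst z (k + 1) \<le> fst z k} \<in> sets S" if "k \<in> {1..<K}" for k
    by (intro borel_measurable_le coord) (use that in auto)
  have 2: "{z \<in> space S. snd z \<le> fst z K} \<in> sets S"
    by (intro borel_measurable_le coord last) (use assms in auto)
  have "{z \<in> space S. \<forall>k\<in>{1..<K}. fst z (k + 1) \<le> fst z k} \<in> sets S"
    by (rule sets.sets_Collect_finite_All) (use 1 in auto)
  from sets.Int[OF this 2] show ?thesis
    by (rule back_subst[where P="\<lambda>A. A \<in> sets S"]) (auto simp: knot_order_def)
qed

definition knot_density ::
  "real ^ 'p::finite ^ 'n::finite \<Rightarrow> real ^ 'p \<Rightarrow> real \<Rightarrow> ('p + 'p) list \<Rightarrow> (nat \<Rightarrow> real) \<Rightarrow> real" where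
  "knot_density X \<beta> \<sigma> is l = (\<Prod>k=1..length is. normal_density (lars_mean X \<beta> is k) (\<sigma> * lars_scale X is k) (l k))"

lemma lars_weight_knot_density:
  "lars_weight X \<beta> \<sigma> is x l = knot_density X \<beta> \<sigma> is l * indicator (knot_order (length is) x) l"
  by (simp add: lars_weight_def knot_density_def knot_order_def Let_def)

lemma knot_density_measurable[measurable]:
  "length is = K \<Longrightarrow> knot_density X \<beta> \<sigma> is \<in> borel_measurable (PiM {1..K} (\<lambda>_. lborel))"
  unfolding knot_density_def by (intro borel_measurable_prod) auto

lemma knot_density_pos:
  assumes "regular_tuple X is" "\<sigma> > 0"
  shows "knot_density X \<beta> \<sigma> is l > 0"
  unfolding knot_density_def
  using lars_scale_pos[OF assms(1)] assms(2) by (intro prod_pos) (auto intro!: normal_density_pos)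

lemma knot_density_PiM:
  assumes reg: "regular_tuple X is" and "\<sigma> > 0"
  shows "density (PiM {1..length is} (\<lambda>_. lborel)) (\<lambda>l. ennreal (knot_density X \<beta> \<sigma> is l))
    = PiM {1..length is} (\<lambda>k. density lborel (\<lambda>x. ennreal (normal_density (lars_mean X \<beta> is k) (\<sigma> * lars_scale X is k) x)))"
    and "(\<integral>\<^sup>+l. ennreal (knot_density X \<beta> \<sigma> is l) \<partial>PiM {1..length is} (\<lambda>_. lborel)) = 1"
proof -
  have p: "prob_space (density lborel (\<lambda>x. ennreal (normal_density (lars_mean X \<beta> is k) (\<sigma> * lars_scale X is k) x)))"
    if "k \<in> {1..length is}" for k
    using lars_scale_pos[OF reg that] \<open>\<sigma> > 0\<close> by (intro prob_space_normal_density) simp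
  have eq: "ennreal (knot_density X \<beta> \<sigma> is l)
      = (\<Prod>k\<in>{1..length is}. ennreal (normal_density (lars_mean X \<beta> is k) (\<sigma> * lars_scale X is k) (l k)))" for l
    unfolding knot_density_def by (intro prod_ennreal[symmetric]) simp
  show 1: "density (PiM {1..length is} (\<lambda>_. lborel)) (\<lambda>l. ennreal (knot_density X \<beta> \<sigma> is l))
    = PiM {1..length is} (\<lambda>k. density lborel (\<lambda>x. ennreal (normal_density (lars_mean X \<beta> is k) (\<sigma> * lars_scale X is k) x)))"
    unfolding eq using p by (intro density_PiM_lborel) auto
  have "prob_space (density (PiM {1..length is} (\<lambda>_. lborel)) (\<lambda>l. ennreal (knot_density X \<beta> \<sigma> is l)))"
    unfolding 1 using p by (intro prob_space_PiM)
  then have "1 = emeasure (density (PiM {1..length is} (\<lambda>_. lborel)) (\<lambda>l. ennreal (knot_density X \<beta> \<sigma> is l)))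
      (space (PiM {1..length is} (\<lambda>_. lborel)))"
    using prob_space.emeasure_space_1 by fastforce
  also have "\<dots> = (\<integral>\<^sup>+l. ennreal (knot_density X \<beta> \<sigma> is l) * indicator (space (PiM {1..length is} (\<lambda>_. lborel))) l
      \<partial>PiM {1..length is} (\<lambda>_. lborel))"
    by (intro emeasure_density measurable_compose[OF knot_density_measurable[OF refl]]) auto
  also have "\<dots> = (\<integral>\<^sup>+l. ennreal (knot_density X \<beta> \<sigma> is l) \<partial>PiM {1..length is} (\<lambda>_. lborel))"
    by (intro nn_integral_cong) simp
  finally show "(\<integral>\<^sup>+l. ennreal (knot_density X \<beta> \<sigma> is l) \<partial>PiM {1..length is} (\<lambda>_. lborel)) = 1" ..
qed

lemma lars_weight_measurable:
  assumes "length is = K" "1 \<le> K"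
  shows "(\<lambda>z. lars_weight X \<beta> \<sigma> is (snd z) (fst z)) \<in> borel_measurable (PiM {1..K} (\<lambda>_. lborel) \<Otimes>\<^sub>M borel)"
proof -
  have [measurable]: "Measurable.pred (PiM {1..K} (\<lambda>_. lborel) \<Otimes>\<^sub>M borel) (\<lambda>z. fst z \<in> knot_order K (snd z))"
    using knot_order_measurable[OF assms(2)] by (simp add: pred_def)
  have "(\<lambda>z. knot_density X \<beta> \<sigma> is (fst z) * (if fst z \<in> knot_order K (snd z) then 1 else 0))
      \<in> borel_measurable (PiM {1..K} (\<lambda>_. lborel) \<Otimes>\<^sub>M borel)"
    using knot_density_measurable[OF assms(1), measurable] by measurable
  then show ?thesis
    by (simp add: lars_weight_knot_density assms(1) indicator_def of_bool_def if_distrib cong: if_cong)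
qed

text \<open>
  The total mass of the weight is at most that of the product density, and it is positive because the
  product density is positive on a set that is not null. So division by \<^const>\<open>lars_Q\<close> is
  meaningful. The second claim, with the mass kept as a factor, is the form that Fubini produces.
\<close>

lemma lars_cond_law_normalized:
  assumes reg: "regular_tuple X is" and len: "length is = K" and "\<sigma> > 0"
  defines "S \<equiv> PiM {1..K} (\<lambda>_. lborel :: real measure)"
  shows "prob_space (lars_cond_law X \<beta> \<sigma> is x)"
    and "A \<in> sets S \<Longrightarrow> emeasure (lars_cond_law X \<beta> \<sigma> is x) A * (\<integral>\<^sup>+l. ennreal (lars_weight X \<beta> \<sigma> is x l) \<partial>S)
      = (\<integral>\<^sup>+l. ennreal (lars_weight X \<beta> \<sigma> is x l) * indicator A l \<partial>S)"
proof -
  have K1: "1 \<le> K" using reg len by (auto simp: regular_tuple_def Suc_le_eq)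
  have w[measurable]: "lars_weight X \<beta> \<sigma> is x \<in> borel_measurable S"
  proof -
    have "(\<lambda>l. (l, x)) \<in> S \<rightarrow>\<^sub>M S \<Otimes>\<^sub>M borel" by (rule measurable_Pair2') simp
    from measurable_compose[OF this lars_weight_measurable[OF len K1, folded S_def]] show ?thesis by simp
  qed
  have nonneg: "0 \<le> lars_weight X \<beta> \<sigma> is x l" for l
    using knot_density_pos[OF reg \<open>\<sigma> > 0\<close>, of \<beta> l] by (simp add: lars_weight_knot_density)
  have fin: "(\<integral>\<^sup>+l. ennreal (lars_weight X \<beta> \<sigma> is x l) \<partial>S) \<noteq> \<infinity>"
  proof -
    have "(\<integral>\<^sup>+l. ennreal (lars_weight X \<beta> \<sigma> is x l) \<partial>S) \<le> (\<integral>\<^sup>+l. ennreal (knot_density X \<beta> \<sigma> is l) \<partial>S)"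
      using knot_density_pos[OF reg \<open>\<sigma> > 0\<close>, of \<beta>]
      by (intro nn_integral_mono ennreal_leI) (auto simp: lars_weight_knot_density indicator_def less_imp_le)
    then show ?thesis using knot_density_PiM(2)[OF reg \<open>\<sigma> > 0\<close>, of \<beta>] by (auto simp: len S_def top_unique)
  qed
  have nz: "(\<integral>\<^sup>+l. ennreal (lars_weight X \<beta> \<sigma> is x l) \<partial>S) \<noteq> 0"
  proof
    assume "(\<integral>\<^sup>+l. ennreal (lars_weight X \<beta> \<sigma> is x l) \<partial>S) = 0"
    then have "AE l in S. ennreal (lars_weight X \<beta> \<sigma> is x l) = 0"
      by (subst (asm) nn_integral_0_iff_AE) auto
    moreover have *: "knot_order K x \<inter> space S = {l \<in> space S. lars_weight X \<beta> \<sigma> is x l \<noteq> 0}"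
      using knot_density_pos[OF reg \<open>\<sigma> > 0\<close>, of \<beta>] by (auto simp: lars_weight_knot_density len indicator_def less_le)
    ultimately have "emeasure S (knot_order K x \<inter> space S) = 0"
      using nonneg by (subst (asm) AE_iff_measurable[OF _ refl]) (auto simp: ennreal_eq_0_iff antisym_conv)
    moreover have "knot_order K x \<inter> space S \<in> sets S" unfolding * by measurable
    ultimately show False using knot_order_not_null[OF K1] unfolding S_def by blast
  qed
  have law: "lars_cond_law X \<beta> \<sigma> is x
      = density S (\<lambda>l. ennreal (inverse (LINT l|S. lars_weight X \<beta> \<sigma> is x l) * lars_weight X \<beta> \<sigma> is x l))"
    by (simp add: lars_cond_law_def lars_Q_def S_def len)
  show "prob_space (lars_cond_law X \<beta> \<sigma> is x)"
    unfolding law by (rule normalized_density(1)[OF w nonneg nz fin])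
  show "emeasure (lars_cond_law X \<beta> \<sigma> is x) A * (\<integral>\<^sup>+l. ennreal (lars_weight X \<beta> \<sigma> is x l) \<partial>S)
      = (\<integral>\<^sup>+l. ennreal (lars_weight X \<beta> \<sigma> is x l) * indicator A l \<partial>S)" if "A \<in> sets S"
    unfolding law by (rule normalized_density(2)[OF w nonneg nz fin that])
qed

lemma lars_cond_law_measurable:
  assumes len: "length is = K" and K1: "1 \<le> K" and A: "A \<in> sets (PiM {1..K} (\<lambda>_. lborel))"
  shows "(\<lambda>x. emeasure (lars_cond_law X \<beta> \<sigma> is x) A) \<in> borel_measurable borel"
proof -
  let ?S = "PiM {1..K} (\<lambda>_. lborel :: real measure)"
  interpret P: product_sigma_finite "\<lambda>_::nat. lborel :: real measure" ..
  interpret S: sigma_finite_measure ?S by (rule P.sigma_finite) simp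
  have w[measurable]: "(\<lambda>z. lars_weight X \<beta> \<sigma> is (fst z) (snd z)) \<in> borel_measurable (borel \<Otimes>\<^sub>M ?S)"
    using measurable_compose[OF measurable_Pair[OF measurable_snd measurable_fst] lars_weight_measurable[OF len K1]]
    by simp
  have Q[measurable]: "(\<lambda>x. lars_Q X \<beta> \<sigma> is x) \<in> borel_measurable borel"
    unfolding lars_Q_def len using w by (intro S.borel_measurable_lebesgue_integral) (simp add: split_beta')
  have [measurable]: "lars_weight X \<beta> \<sigma> is x \<in> borel_measurable ?S" for x
    using measurable_compose[OF measurable_Pair1' w, of x] by simp
  have "emeasure (lars_cond_law X \<beta> \<sigma> is x) A
      = (\<integral>\<^sup>+l. ennreal (inverse (lars_Q X \<beta> \<sigma> is x) * lars_weight X \<beta> \<sigma> is x l) * indicator A l \<partial>?S)" for x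
    unfolding lars_cond_law_def len by (intro emeasure_density A) measurable
  moreover have "(\<lambda>x. \<integral>\<^sup>+l. ennreal (inverse (lars_Q X \<beta> \<sigma> is x) * lars_weight X \<beta> \<sigma> is x l) * indicator A l \<partial>?S)
      \<in> borel_measurable borel"
  proof (rule S.borel_measurable_nn_integral)
    note A[measurable]
    show "(\<lambda>(x, l). ennreal (inverse (lars_Q X \<beta> \<sigma> is x) * lars_weight X \<beta> \<sigma> is x l) * indicator A l)
        \<in> borel_measurable (borel \<Otimes>\<^sub>M ?S)"
      unfolding split_beta' by measurable
  qed
  ultimately show ?thesis by simp
qed

section \<open>The law of the knots on a selected tuple\<close>

text \<open>
  The normalized knot directions are the orthonormal family of \<open>gaussian_projections_law\<close>: each
  frozen knot is its mean plus its scale times the projection of the noise on its direction, and the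
  frozen top is invariant under shifts along all of them.
\<close>

lemma frozen_knots_law:
  fixes \<eta> :: "'a \<Rightarrow> real ^ 'n::finite" and X :: "real ^ 'p::finite ^ 'n" and \<beta> :: "real ^ 'p"
  assumes reg: "regular_tuple X is" and len: "length is = K"
    and "prob_space M" and "\<sigma> > 0"
    and \<eta>: "distributed M lborel \<eta> (\<lambda>x. ennreal (\<Prod>i\<in>UNIV. normal_density 0 \<sigma> (x $ i)))"
    and F[measurable]: "F \<in> borel_measurable (PiM {1..K} (\<lambda>_. lborel) \<Otimes>\<^sub>M borel)"
  defines "S \<equiv> PiM {1..K} (\<lambda>_. lborel :: real measure)"
  defines "y \<equiv> \<lambda>\<omega>. X *v \<beta> + \<eta> \<omega>"
  shows "(\<integral>\<^sup>+\<omega>. F (\<lambda>k\<in>{1..K}. frozen_knot X is (y \<omega>) k, frozen_top X is (y \<omega>)) \<partial>M)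
    = (\<integral>\<^sup>+x. (\<integral>\<^sup>+l. ennreal (knot_density X \<beta> \<sigma> is l) * F (l, x) \<partial>S) \<partial>distr M borel (\<lambda>\<omega>. frozen_top X is (y \<omega>)))"
proof -
  interpret prob_space M by fact
  have [measurable]: "\<eta> \<in> M \<rightarrow>\<^sub>M borel" using \<eta> by (auto simp: distributed_def)
  have K1: "1 \<le> K" using reg len by (auto simp: regular_tuple_def Suc_le_eq)
  define e where "e k = knot_dir X is k /\<^sub>R norm (knot_dir X is k)" for k
  define g where "g z = frozen_top X is (X *v \<beta> + z)" for z
  have kk: "k \<in> {1..length is}" if "k \<in> {1..K}" for k using that len by simp
  have g[measurable]: "g \<in> borel_measurable borel"
    unfolding g_def by (rule measurable_compose[OF _ frozen_top_measurable[OF reg]]) simp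
  have e: "e j \<bullet> e k = (if j = k then 1 else 0)" if "j \<in> {1..K}" "k \<in> {1..K}" for j k
    using knot_dir_orth[OF reg kk[OF that(1)] kk[OF that(2)]] knot_dir_nonzero[OF reg kk[OF that(1)]]
    by (auto simp: e_def power2_norm_eq_inner[symmetric] power2_eq_square field_simps)
  have inv: "g (x + t *\<^sub>R e k) = g x" if "k \<in> {1..K}" for x k t
    using frozen_top_shift[OF reg kk[OF that], of "X *v \<beta> + x" "t / norm (knot_dir X is k)"]
    by (simp add: g_def e_def add.assoc divide_inverse)
  have knot: "frozen_knot X is (y \<omega>) k = lars_mean X \<beta> is k + lars_scale X is k * (e k \<bullet> \<eta> \<omega>)" if "k \<in> {1..K}" for k \<omega>
    using knot_dir_nonzero[OF reg kk[OF that]] knot_gap_pos[OF reg kk[OF that]]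
    by (simp add: lars_mean_knot y_def frozen_knot_dir[OF reg kk[OF that]] lars_scale_knot[OF reg kk[OF that]]
        e_def inner_add_right field_simps)
  let ?\<Lambda> = "\<lambda>\<omega>. \<lambda>k\<in>{1..K}. lars_mean X \<beta> is k + lars_scale X is k * (e k \<bullet> \<eta> \<omega>)"
  let ?\<nu> = "distr M borel (\<lambda>\<omega>. g (\<eta> \<omega>))"
  let ?d = "density S (\<lambda>l. ennreal (knot_density X \<beta> \<sigma> is l))"
  have law: "distr M (PiM {1..K} (\<lambda>_. borel) \<Otimes>\<^sub>M borel) (\<lambda>\<omega>. (?\<Lambda> \<omega>, g (\<eta> \<omega>)))
      = PiM {1..K} (\<lambda>k. density lborel (\<lambda>x. ennreal (normal_density (lars_mean X \<beta> is k) (\<sigma> * lars_scale X is k) x))) \<Otimes>\<^sub>M ?\<nu>"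
    using K1 lars_scale_pos[OF reg kk]
    by (intro gaussian_projections_law[OF \<open>prob_space M\<close> \<open>\<sigma> > 0\<close> \<eta> _ _ e _ g inv]) auto
  also have "PiM {1..K} (\<lambda>k. density lborel (\<lambda>x. ennreal (normal_density (lars_mean X \<beta> is k) (\<sigma> * lars_scale X is k) x))) = ?d"
    unfolding S_def using knot_density_PiM(1)[OF reg \<open>\<sigma> > 0\<close>, of \<beta>] by (simp add: len)
  finally have law: "distr M (PiM {1..K} (\<lambda>_. borel) \<Otimes>\<^sub>M borel) (\<lambda>\<omega>. (?\<Lambda> \<omega>, g (\<eta> \<omega>))) = ?d \<Otimes>\<^sub>M ?\<nu>" .
  have meas: "(\<lambda>\<omega>. (?\<Lambda> \<omega>, g (\<eta> \<omega>))) \<in> M \<rightarrow>\<^sub>M PiM {1..K} (\<lambda>_. borel) \<Otimes>\<^sub>M borel"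
    by measurable
  have kd[measurable]: "knot_density X \<beta> \<sigma> is \<in> borel_measurable S"
    unfolding S_def by (rule knot_density_measurable[OF len])
  have FS[measurable]: "F \<in> borel_measurable (S \<Otimes>\<^sub>M borel)" using F by (simp add: S_def)
  have sets_eq: "sets (PiM {1..K} (\<lambda>_. borel) \<Otimes>\<^sub>M borel) = sets (S \<Otimes>\<^sub>M (borel :: real measure))"
    unfolding S_def by (intro sets_pair_measure_cong sets_PiM_cong) auto
  have FB[measurable]: "F \<in> borel_measurable (PiM {1..K} (\<lambda>_. borel) \<Otimes>\<^sub>M borel)"
    by (subst measurable_cong_sets[OF sets_eq refl]) (rule FS)
  have "prob_space ?d"
    using knot_density_PiM(2)[OF reg \<open>\<sigma> > 0\<close>, of \<beta>]
    unfolding len S_def[symmetric] by (intro prob_spaceI) (simp add: emeasure_density cong: nn_integral_cong_simp)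
  then interpret D: prob_space ?d .
  have "prob_space ?\<nu>" by (rule prob_space_distr) simp
  then interpret N: prob_space ?\<nu> .
  interpret DN: pair_sigma_finite ?d ?\<nu> ..
  have "(\<integral>\<^sup>+\<omega>. F (\<lambda>k\<in>{1..K}. frozen_knot X is (y \<omega>) k, frozen_top X is (y \<omega>)) \<partial>M)
      = (\<integral>\<^sup>+\<omega>. F (?\<Lambda> \<omega>, g (\<eta> \<omega>)) \<partial>M)"
    by (intro nn_integral_cong arg_cong[where f=F]) (auto simp: knot[unfolded y_def] g_def y_def fun_eq_iff)
  also have "\<dots> = (\<integral>\<^sup>+z. F z \<partial>(?d \<Otimes>\<^sub>M ?\<nu>))"
    unfolding law[symmetric] 
    by (rule nn_integral_distr[OF meas, symmetric], subst measurable_cong_sets[OF sets_distr refl]) (rule FB)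
  also have "\<dots> = (\<integral>\<^sup>+x. (\<integral>\<^sup>+l. F (l, x) \<partial>?d) \<partial>?\<nu>)"
    by (subst DN.nn_integral_snd[symmetric]) (auto simp: measurable_cong_sets[OF sets_pair_measure_cong[OF sets_density sets_distr] refl])
  also have "\<dots> = (\<integral>\<^sup>+x. (\<integral>\<^sup>+l. ennreal (knot_density X \<beta> \<sigma> is l) * F (l, x) \<partial>S) \<partial>?\<nu>)"
    by (intro nn_integral_cong nn_integral_density) auto
  finally show ?thesis by (simp add: g_def y_def)
qed

text \<open>
  Also for a singular matrix, where the inverse is an unspecified matrix, \<^const>\<open>lars_proj\<close> is a
  linear combination of the values of \<open>f\<close> with constant coefficients. So the knots are measurable on
  every event of selection, and not only where the check holds.
\<close>

lemma lars_proj_sum: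
  fixes X :: "real ^ 'p::finite ^ 'n::finite"
  defines "N \<equiv> \<lambda>is. the (mat_inverse (lars_M X is))"
  shows "lars_proj X is f j = (\<Sum>b<dim_row (N is).
    vec_index (Matrix.vec (length is) (\<lambda>a. signed_gram X $ j $ (is ! a))) b
      * (\<Sum>a<length is. vec_index (Matrix.row (N is) b) a * f (is ! a)))"
  by (simp add: lars_proj_def scalar_prod_def N_def atLeast0LessThan)

lemma selected_list_measurable:
  fixes ih :: "nat \<Rightarrow> 'a \<Rightarrow> 'i::countable"
  assumes ih: "\<And>k. k \<in> set xs \<Longrightarrow> ih k \<in> M \<rightarrow>\<^sub>M count_space UNIV"
  shows "(\<lambda>\<omega>. map (\<lambda>k. ih k \<omega>) xs) \<in> M \<rightarrow>\<^sub>M count_space UNIV"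
  using assms
proof (induction xs)
  case (Cons a xs)
  have tail: "(\<lambda>\<omega>. i # map (\<lambda>k. ih k \<omega>) xs) \<in> M \<rightarrow>\<^sub>M count_space UNIV" for i
    using Cons by (intro measurable_compose[where g="\<lambda>is. i # is", OF Cons.IH]) auto
  have "(\<lambda>\<omega>. (\<lambda>i \<omega>. i # map (\<lambda>k. ih k \<omega>) xs) (ih a \<omega>) \<omega>) \<in> M \<rightarrow>\<^sub>M count_space UNIV"
    by (rule measurable_compose_countable'[where I=UNIV, OF tail]) (use Cons.prems in auto)
  then show ?case by simp
qed simp

lemma lars_knot_measurable:
  assumes path: "\<And>\<omega>. \<omega> \<in> space M \<Longrightarrow> lars_path X (Y \<omega>) N (\<lambda>k. lam k \<omega>) (\<lambda>k. ih k \<omega>)"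
    and Y[measurable]: "Y \<in> M \<rightarrow>\<^sub>M borel"
    and ih: "\<And>k. k \<in> {1..N} \<Longrightarrow> ih k \<in> M \<rightarrow>\<^sub>M count_space UNIV"
    and k: "k \<in> {1..N}"
  shows "lam k \<in> borel_measurable M"
proof -
  have sel: "(\<lambda>\<omega>. map (\<lambda>k. ih k \<omega>) [1..<k]) \<in> M \<rightarrow>\<^sub>M count_space UNIV"
    by (rule selected_list_measurable) (use ih k in auto)
  have [measurable]: "(\<lambda>\<omega>. lars_ratio X is (Y \<omega>) i) \<in> borel_measurable M" for "is" i
    unfolding lars_ratio_def lars_Pi_def lars_proj_sum signed_vec_inner by measurable
  have "(\<lambda>\<omega>. lars_ratio X (map (\<lambda>k. ih k \<omega>) [1..<k]) (Y \<omega>) (ih k \<omega>)) \<in> borel_measurable M"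
  proof -
    have at: "(\<lambda>\<omega>. lars_ratio X is (Y \<omega>) (ih k \<omega>)) \<in> borel_measurable M" for "is"
      by (rule measurable_compose_countable'[where I=UNIV and f="\<lambda>i \<omega>. lars_ratio X is (Y \<omega>) i"])
        (use ih[OF k] in auto)
    show ?thesis
      by (rule measurable_compose_countable'[where I=UNIV and f="\<lambda>is \<omega>. lars_ratio X is (Y \<omega>) (ih k \<omega>)", OF at sel])
        (use k in auto)
  qed
  then show ?thesis
    by (rule measurable_cong[THEN iffD1, rotated]) (use lars_pathD(1)[OF path k] in simp)
qed

text \<open>
  On the event of selection the knots can be replaced by the frozen ones, and up to a null set the
  event says that these decrease. What remains is an integral against the product law of
  \<open>frozen_knots_law\<close>; the indicator of the order turns the product density into the LARS weight.
\<close>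

lemma selected_tuple_integral:
  fixes \<eta> :: "'a \<Rightarrow> real ^ 'n::finite" and X :: "real ^ 'p::finite ^ 'n" and \<beta> :: "real ^ 'p"
    and ih :: "nat \<Rightarrow> 'a \<Rightarrow> 'p + 'p"
  assumes reg: "regular_tuple X is" and len: "length is = K"
    and "prob_space M" and "\<sigma> > 0"
    and \<eta>: "distributed M lborel \<eta> (\<lambda>x. ennreal (\<Prod>i\<in>UNIV. normal_density 0 \<sigma> (x $ i)))"
    and Y: "\<And>\<omega>. \<omega> \<in> space M \<Longrightarrow> Y \<omega> = X *v \<beta> + \<eta> \<omega>"
    and path: "\<And>\<omega>. \<omega> \<in> space M \<Longrightarrow> lars_path X (Y \<omega>) (K + 1) (\<lambda>k. lam k \<omega>) (\<lambda>k. ih k \<omega>)"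
    and \<phi>[measurable]: "\<phi> \<in> borel_measurable (PiM {1..K} (\<lambda>_. lborel) \<Otimes>\<^sub>M borel)"
  shows "(\<integral>\<^sup>+\<omega>. indicator {\<omega>. map (\<lambda>k. ih k \<omega>) [1..<K + 1] = is} \<omega> * \<phi> (\<lambda>k\<in>{1..K}. lam k \<omega>, lam (K + 1) \<omega>) \<partial>M)
    = (\<integral>\<^sup>+x. (\<integral>\<^sup>+l. ennreal (lars_weight X \<beta> \<sigma> is x l) * \<phi> (l, x) \<partial>PiM {1..K} (\<lambda>_. lborel))
        \<partial>distr M borel (\<lambda>\<omega>. frozen_top X is (X *v \<beta> + \<eta> \<omega>)))"
proof -
  have K1: "1 \<le> K" using reg len by (auto simp: regular_tuple_def Suc_le_eq)
  have chk: "irrepresentable_check X is" and dist: "distinct is"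
    using reg regular_tuple_distinct by (auto simp: regular_tuple_def)
  define F where "F z = (if fst z \<in> knot_order K (snd z) then \<phi> z else 0)" for z
  have [measurable]: "Measurable.pred (PiM {1..K} (\<lambda>_. lborel) \<Otimes>\<^sub>M borel) (\<lambda>z. fst z \<in> knot_order K (snd z))"
    using knot_order_measurable[OF K1] by (simp add: pred_def)
  have F: "F \<in> borel_measurable (PiM {1..K} (\<lambda>_. lborel) \<Otimes>\<^sub>M borel)"
    unfolding F_def by measurable
  let ?y = "\<lambda>\<omega>. X *v \<beta> + \<eta> \<omega>"
  have ae: "AE \<omega> in M. map (\<lambda>k. ih k \<omega>) [1..<K + 1] = is \<longleftrightarrow>
      frozen_knot X is (Y \<omega>) \<in> knot_order K (frozen_top X is (Y \<omega>))"
    by (rule AE_selected_iff_ordered[where lam=lam, OF reg len \<eta>]) (erule Y, erule path)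
  have "(\<integral>\<^sup>+\<omega>. indicator {\<omega>. map (\<lambda>k. ih k \<omega>) [1..<K + 1] = is} \<omega> * \<phi> (\<lambda>k\<in>{1..K}. lam k \<omega>, lam (K + 1) \<omega>) \<partial>M)
      = (\<integral>\<^sup>+\<omega>. F (\<lambda>k\<in>{1..K}. frozen_knot X is (?y \<omega>) k, frozen_top X is (?y \<omega>)) \<partial>M)"
  proof (rule nn_integral_cong_AE)
    show "AE \<omega> in M. indicator {\<omega>. map (\<lambda>k. ih k \<omega>) [1..<K + 1] = is} \<omega> * \<phi> (\<lambda>k\<in>{1..K}. lam k \<omega>, lam (K + 1) \<omega>)
        = F (\<lambda>k\<in>{1..K}. frozen_knot X is (?y \<omega>) k, frozen_top X is (?y \<omega>))"
      using ae AE_space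
    proof eventually_elim
      case (elim \<omega>)
      note p = path[OF elim(2)]
      have res: "(\<lambda>k\<in>{1..K}. frozen_knot X is (Y \<omega>) k) \<in> knot_order K x \<longleftrightarrow> frozen_knot X is (Y \<omega>) \<in> knot_order K x" for x
        using K1 by (auto simp: knot_order_def)
      show ?case
      proof (cases "map (\<lambda>k. ih k \<omega>) [1..<K + 1] = is")
        case True
        have "(\<lambda>k\<in>{1..K}. lam k \<omega>) = (\<lambda>k\<in>{1..K}. frozen_knot X is (Y \<omega>) k)"
          using selected_imp_ordered(1)[OF p True chk dist K1] by (auto simp: fun_eq_iff restrict_def)
        moreover have "lam (K + 1) \<omega> = frozen_top X is (Y \<omega>)"
          by (rule selected_imp_ordered(2)[OF p True chk dist K1])
        moreover have "frozen_knot X is (Y \<omega>) \<in> knot_order K (frozen_top X is (Y \<omega>))"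
          using elim(1) True by blast
        ultimately show ?thesis
          unfolding F_def fst_conv snd_conv Y[OF elim(2), symmetric] res using True by (simp del: upt_Suc)
      next
        case False
        then have "frozen_knot X is (Y \<omega>) \<notin> knot_order K (frozen_top X is (Y \<omega>))"
          using elim(1) by blast
        then show ?thesis
          unfolding F_def fst_conv snd_conv Y[OF elim(2), symmetric] res using False by (simp del: upt_Suc)
      qed
    qed
  qed
  also have "\<dots> = (\<integral>\<^sup>+x. (\<integral>\<^sup>+l. ennreal (knot_density X \<beta> \<sigma> is l) * F (l, x) \<partial>PiM {1..K} (\<lambda>_. lborel))
      \<partial>distr M borel (\<lambda>\<omega>. frozen_top X is (?y \<omega>)))"
    by (rule frozen_knots_law[OF reg len \<open>prob_space M\<close> \<open>\<sigma> > 0\<close> \<eta> F])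
  also have "\<dots> = (\<integral>\<^sup>+x. (\<integral>\<^sup>+l. ennreal (lars_weight X \<beta> \<sigma> is x l) * \<phi> (l, x) \<partial>PiM {1..K} (\<lambda>_. lborel))
      \<partial>distr M borel (\<lambda>\<omega>. frozen_top X is (?y \<omega>)))"
    by (intro nn_integral_cong) (simp add: F_def lars_weight_knot_density len indicator_def)
  finally show ?thesis .
qed

text \<open>
  The defining identity of the conditional distribution, on the event that one fixed tuple is
  selected. Both sides become integrals over the law of the frozen top. There the total weight times
  the kernel is the weight of \<open>A\<close>, by normalization.
\<close>

lemma selected_tuple_kernel:
  fixes \<eta> :: "'a \<Rightarrow> real ^ 'n::finite" and X :: "real ^ 'p::finite ^ 'n" and \<beta> :: "real ^ 'p"
    and ih :: "nat \<Rightarrow> 'a \<Rightarrow> 'p + 'p"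
  assumes reg: "regular_tuple X is" and len: "length is = K"
    and "prob_space M" and "\<sigma> > 0"
    and \<eta>: "distributed M lborel \<eta> (\<lambda>x. ennreal (\<Prod>i\<in>UNIV. normal_density 0 \<sigma> (x $ i)))"
    and Y: "\<And>\<omega>. \<omega> \<in> space M \<Longrightarrow> Y \<omega> = X *v \<beta> + \<eta> \<omega>"
    and path: "\<And>\<omega>. \<omega> \<in> space M \<Longrightarrow> lars_path X (Y \<omega>) (K + 1) (\<lambda>k. lam k \<omega>) (\<lambda>k. ih k \<omega>)"
    and A[measurable]: "A \<in> sets (PiM {1..K} (\<lambda>_. lborel))" and E[measurable]: "E \<in> sets borel"
  shows "(\<integral>\<^sup>+\<omega>. indicator {\<omega>. map (\<lambda>k. ih k \<omega>) [1..<K + 1] = is} \<omega>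
        * (indicator A (\<lambda>k\<in>{1..K}. lam k \<omega>) * indicator E (lam (K + 1) \<omega>)) \<partial>M)
    = (\<integral>\<^sup>+\<omega>. indicator {\<omega>. map (\<lambda>k. ih k \<omega>) [1..<K + 1] = is} \<omega>
        * (emeasure (lars_cond_law X \<beta> \<sigma> is (lam (K + 1) \<omega>)) A * indicator E (lam (K + 1) \<omega>)) \<partial>M)"
proof -
  have K1: "1 \<le> K" using reg len by (auto simp: regular_tuple_def Suc_le_eq)
  let ?S = "PiM {1..K} (\<lambda>_. lborel :: real measure)"
  have law[measurable]: "(\<lambda>x. emeasure (lars_cond_law X \<beta> \<sigma> is x) A) \<in> borel_measurable borel"
    by (rule lars_cond_law_measurable[OF len K1 A])
  have w: "lars_weight X \<beta> \<sigma> is x \<in> borel_measurable ?S" for x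
  proof -
    have "(\<lambda>l. (l, x)) \<in> ?S \<rightarrow>\<^sub>M ?S \<Otimes>\<^sub>M borel" by (rule measurable_Pair2') simp
    from measurable_compose[OF this lars_weight_measurable[OF len K1]] show ?thesis by simp
  qed
  note w[measurable]
  have 1: "(\<lambda>z. indicator A (fst z) * indicator E (snd z) :: ennreal) \<in> borel_measurable (?S \<Otimes>\<^sub>M borel)"
    by measurable
  have 2: "(\<lambda>z. emeasure (lars_cond_law X \<beta> \<sigma> is (snd z)) A * indicator E (snd z)) \<in> borel_measurable (?S \<Otimes>\<^sub>M borel)"
    by measurable
  have "(\<integral>\<^sup>+l. ennreal (lars_weight X \<beta> \<sigma> is x l) * (indicator A l * indicator E x) \<partial>?S)
      = (\<integral>\<^sup>+l. ennreal (lars_weight X \<beta> \<sigma> is x l) * (emeasure (lars_cond_law X \<beta> \<sigma> is x) A * indicator E x) \<partial>?S)" for x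
  proof -
    have "(\<integral>\<^sup>+l. ennreal (lars_weight X \<beta> \<sigma> is x l) * (indicator A l * indicator E x) \<partial>?S)
        = (\<integral>\<^sup>+l. ennreal (lars_weight X \<beta> \<sigma> is x l) * indicator A l \<partial>?S) * indicator E x"
      unfolding mult.assoc[symmetric] by (rule nn_integral_multc) measurable
    also have "\<dots> = (\<integral>\<^sup>+l. ennreal (lars_weight X \<beta> \<sigma> is x l) \<partial>?S) * (emeasure (lars_cond_law X \<beta> \<sigma> is x) A * indicator E x)"
      unfolding lars_cond_law_normalized(2)[OF reg len \<open>\<sigma> > 0\<close> A, symmetric] by (simp only: mult_ac)
    also have "\<dots> = (\<integral>\<^sup>+l. ennreal (lars_weight X \<beta> \<sigma> is x l) * (emeasure (lars_cond_law X \<beta> \<sigma> is x) A * indicator E x) \<partial>?S)"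
      by (rule nn_integral_multc[symmetric]) measurable
    finally show ?thesis .
  qed
  note inner = this
  have int: "(\<integral>\<^sup>+\<omega>. indicator {\<omega>. map (\<lambda>k. ih k \<omega>) [1..<K + 1] = is} \<omega> * \<phi> (\<lambda>k\<in>{1..K}. lam k \<omega>, lam (K + 1) \<omega>) \<partial>M)
      = (\<integral>\<^sup>+x. (\<integral>\<^sup>+l. ennreal (lars_weight X \<beta> \<sigma> is x l) * \<phi> (l, x) \<partial>?S)
        \<partial>distr M borel (\<lambda>\<omega>. frozen_top X is (X *v \<beta> + \<eta> \<omega>)))"
    if "\<phi> \<in> borel_measurable (?S \<Otimes>\<^sub>M borel)" for \<phi>
    by (rule selected_tuple_integral[where Y=Y, OF reg len \<open>prob_space M\<close> \<open>\<sigma> > 0\<close> \<eta> _ _ that]) (erule Y, erule path)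
  show ?thesis
    using int[OF 1] int[OF 2] inner by (simp only: fst_conv snd_conv)
qed

text \<open>
  There are countably many tuples, so joint measurability reduces to measurability in the last knot
  for each tuple.
\<close>

lemma lars_cond_law_kernel:
  fixes X :: "real ^ 'p::finite ^ 'n::finite"
  assumes "\<sigma> > 0" and "1 \<le> K"
  defines "G \<equiv> {is \<in> lars_tuples K. irrepresentable_check X is}"
  shows "(\<lambda>(is, x). lars_cond_law X \<beta> \<sigma> is x)
    \<in> restrict_space (count_space UNIV \<Otimes>\<^sub>M borel) (G \<times> UNIV) \<rightarrow>\<^sub>M prob_algebra (PiM {1..K} (\<lambda>_. lborel))"
proof (intro measurable_prob_algebraI measurable_subprob_algebra)
  let ?R = "restrict_space (count_space UNIV \<Otimes>\<^sub>M borel) (G \<times> (UNIV :: real set))"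
  have reg: "regular_tuple X is" "length is = K" if "is \<in> G" for "is"
    using that \<open>1 \<le> K\<close> by (auto simp: G_def lars_tuples_def regular_tuple_def)
  have sp: "z \<in> space ?R \<longleftrightarrow> fst z \<in> G" for z
    by (auto simp: space_restrict_space space_pair_measure mem_Times_iff)
  show prob: "prob_space ((\<lambda>(is, x). lars_cond_law X \<beta> \<sigma> is x) z)" if "z \<in> space ?R" for z
    using lars_cond_law_normalized(1)[OF reg assms(1)] that by (simp add: sp split_beta mem_Times_iff)
  then show "subprob_space ((\<lambda>(is, x). lars_cond_law X \<beta> \<sigma> is x) z)" if "z \<in> space ?R" for z
    using that by (intro prob_space_imp_subprob_space)
  show "sets ((\<lambda>(is, x). lars_cond_law X \<beta> \<sigma> is x) z) = sets (PiM {1..K} (\<lambda>_. lborel))" if "z \<in> space ?R" for z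
    using reg(2) that by (simp add: sp split_beta lars_cond_law_def mem_Times_iff)
  fix A assume A: "A \<in> sets (PiM {1..K} (\<lambda>_. lborel :: real measure))"
  have "(\<lambda>z. if fst z \<in> G then emeasure (lars_cond_law X \<beta> \<sigma> (fst z) (snd z)) A else 0)
      \<in> borel_measurable (count_space UNIV \<Otimes>\<^sub>M borel)"
  proof (rule measurable_pair_measure_countable1)
    fix "is" :: "('p + 'p) list"
    show "(\<lambda>x. if fst (is, x) \<in> G then emeasure (lars_cond_law X \<beta> \<sigma> (fst (is, x)) (snd (is, x))) A else 0)
        \<in> borel_measurable borel"
      using lars_cond_law_measurable[OF reg(2) \<open>1 \<le> K\<close> A] by (cases "is \<in> G") auto
  qed simp
  from measurable_restrict_space1[OF this, of "G \<times> UNIV"]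
  show "(\<lambda>z. emeasure ((\<lambda>(is, x). lars_cond_law X \<beta> \<sigma> is x) z) A) \<in> borel_measurable ?R"
    by (rule measurable_cong[THEN iffD1, rotated]) (auto simp: sp split_beta)
qed

theorem theorem1:
  fixes X :: "real ^ 'p::finite ^ 'n::finite" and \<beta> :: "real ^ 'p" and \<sigma> :: real
    and r K :: nat
    and M :: "'a measure" and \<eta> Y :: "'a \<Rightarrow> real ^ 'n"
    and lam :: "nat \<Rightarrow> 'a \<Rightarrow> real" and ih :: "nat \<Rightarrow> 'a \<Rightarrow> 'p + 'p"
  assumes "prob_space M"
    and "rank X = r" and "r > 0"
    and "1 \<le> K" and "K < min CARD('n) r"
    and "\<sigma> > 0"
    and "distributed M lborel \<eta> (\<lambda>x. ennreal (\<Prod>i\<in>UNIV. normal_density 0 \<sigma> (x $ i)))"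
    and "\<And>\<omega>. \<omega> \<in> space M \<Longrightarrow> Y \<omega> = X *v \<beta> + \<eta> \<omega>"
    and "\<And>\<omega>. \<omega> \<in> space M \<Longrightarrow> lars_path X (Y \<omega>) (K + 1) (\<lambda>k. lam k \<omega>) (\<lambda>k. ih k \<omega>)"
    and "\<And>k. k \<in> {1..K + 1} \<Longrightarrow> ih k \<in> M \<rightarrow>\<^sub>M count_space UNIV"
  shows "cond_distr_on M
    (PiM {1..K} (\<lambda>_. lborel)) (\<lambda>\<omega>. \<lambda>k\<in>{1..K}. lam k \<omega>)
    (count_space UNIV \<Otimes>\<^sub>M borel) (\<lambda>\<omega>. (map (\<lambda>k. ih k \<omega>) [1..<K + 1], lam (K + 1) \<omega>))
    ({is \<in> lars_tuples K. irrepresentable_check X is} \<times> UNIV)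
    (\<lambda>(is, x). lars_cond_law X \<beta> \<sigma> is x)"
proof -
  note \<eta> = assms(7) and Y = assms(8) and path = assms(9) and ih = assms(10)
  define G where "G = {is \<in> lars_tuples K. irrepresentable_check X is}"
  define S where "S = PiM {1..K} (\<lambda>_. lborel :: real measure)"
  define sel where "sel \<omega> = map (\<lambda>k. ih k \<omega>) [1..<K + 1]" for \<omega>
  have "finite {is :: ('p + 'p) list. set is \<subseteq> UNIV \<and> length is = K}" by (rule finite_lists_length_eq) simp
  then have fin: "finite G" by (rule rev_finite_subset) (auto simp: G_def lars_tuples_def)
  have reg: "regular_tuple X is" "length is = K" if "is \<in> G" for "is"
    using that \<open>1 \<le> K\<close> by (auto simp: G_def lars_tuples_def regular_tuple_def)
  have [measurable]: "\<eta> \<in> M \<rightarrow>\<^sub>M borel" using \<eta> by (auto simp: distributed_def)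
  have Ymeas: "Y \<in> M \<rightarrow>\<^sub>M borel"
    by (rule measurable_cong[THEN iffD2, OF Y]) auto
  have lam[measurable]: "lam k \<in> borel_measurable M" if "k \<in> {1..K + 1}" for k
    by (rule lars_knot_measurable[OF path Ymeas ih that])
  have sel_meas[measurable]: "sel \<in> M \<rightarrow>\<^sub>M count_space UNIV"
    unfolding sel_def by (rule selected_list_measurable) (use ih in auto)
  have U[measurable]: "(\<lambda>\<omega>. \<lambda>k\<in>{1..K}. lam k \<omega>) \<in> M \<rightarrow>\<^sub>M S"
    unfolding S_def using lam by (intro measurable_restrict) auto
  have last[measurable]: "lam (K + 1) \<in> borel_measurable M" by (rule lam) simp
  have V: "(\<lambda>\<omega>. (sel \<omega>, lam (K + 1) \<omega>)) \<in> M \<rightarrow>\<^sub>M count_space UNIV \<Otimes>\<^sub>M borel"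
    by measurable
  have "cond_distr_on M S (\<lambda>\<omega>. \<lambda>k\<in>{1..K}. lam k \<omega>) (count_space UNIV \<Otimes>\<^sub>M borel)
      (\<lambda>\<omega>. (sel \<omega>, lam (K + 1) \<omega>)) (G \<times> UNIV) (\<lambda>(is, x). lars_cond_law X \<beta> \<sigma> is x)"
  proof (rule cond_distr_onI[OF assms(1) U V])
    show "G \<times> UNIV \<in> sets (count_space UNIV \<Otimes>\<^sub>M (borel :: real measure))" by (intro pair_measureI) auto
    show "(\<lambda>(is, x). lars_cond_law X \<beta> \<sigma> is x)
        \<in> restrict_space (count_space UNIV \<Otimes>\<^sub>M borel) (G \<times> UNIV) \<rightarrow>\<^sub>M prob_algebra S"
      unfolding G_def S_def by (rule lars_cond_law_kernel[OF \<open>\<sigma> > 0\<close> \<open>1 \<le> K\<close>])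
    fix A E
    assume A[measurable]: "A \<in> sets S" and E[measurable]: "E \<in> sets (count_space UNIV \<Otimes>\<^sub>M (borel :: real measure))"
      and EG: "E \<subseteq> G \<times> UNIV"
    have slice[measurable]: "Pair is -` E \<in> sets borel" for "is"
      by (rule sets_Pair1) (rule E)
    have law: "(\<lambda>\<omega>. emeasure (lars_cond_law X \<beta> \<sigma> is (lam (K + 1) \<omega>)) A) \<in> borel_measurable M" if "is \<in> G" for "is"
      using lars_cond_law_measurable[OF reg(2)[OF that] \<open>1 \<le> K\<close> A[unfolded S_def]] last by (rule measurable_compose[rotated])
    have sel_ind: "indicator {\<omega>. sel \<omega> = is} \<in> borel_measurable M" for "is"
    proof -
      have "(\<lambda>\<omega>. indicator {is} (sel \<omega>)) \<in> borel_measurable M"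
        by (rule measurable_compose[OF sel_meas]) simp
      then show ?thesis by (rule back_subst[where P="\<lambda>f. f \<in> _"]) (auto simp: indicator_def fun_eq_iff)
    qed
    have slice_ind: "(\<lambda>\<omega>. indicator (Pair is -` E) (lam (K + 1) \<omega>)) \<in> borel_measurable M" for "is"
      by (rule measurable_compose[OF last borel_measurable_indicator[OF slice]])
    have A_ind: "(\<lambda>\<omega>. indicator A (\<lambda>k\<in>{1..K}. lam k \<omega>)) \<in> borel_measurable M"
      by (rule measurable_compose[OF U borel_measurable_indicator[OF A]])
    \<comment> \<open>Both sides split over the tuples; \<open>E\<close> lies over \<open>G\<close>, so no event of selection is lost.\<close>
    have decompose: "(\<Sum>is\<in>G. indicator {\<omega>. sel \<omega> = is} \<omega> * (c is * indicator (Pair is -` E) x))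
        = indicator E (sel \<omega>, x) * c (sel \<omega>)" for \<omega> x and c :: "_ \<Rightarrow> ennreal"
    proof -
      have "(\<Sum>is\<in>G. indicator {\<omega>. sel \<omega> = is} \<omega> * (c is * indicator (Pair is -` E) x))
          = (\<Sum>is\<in>G. if sel \<omega> = is then c is * indicator (Pair is -` E) x else 0)"
        by (intro sum.cong) auto
      also have "\<dots> = (if sel \<omega> \<in> G then c (sel \<omega>) * indicator (Pair (sel \<omega>) -` E) x else 0)"
        using fin by simp
      also have "\<dots> = indicator E (sel \<omega>, x) * c (sel \<omega>)"
        using EG by (auto simp: indicator_def)
      finally show ?thesis .
    qed
    let ?U = "\<lambda>\<omega>. \<lambda>k\<in>{1..K}. lam k \<omega>"
    have "emeasure M {\<omega> \<in> space M. ?U \<omega> \<in> A \<and> (sel \<omega>, lam (K + 1) \<omega>) \<in> E}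
        = (\<integral>\<^sup>+\<omega>. indicator {\<omega> \<in> space M. ?U \<omega> \<in> A \<and> (sel \<omega>, lam (K + 1) \<omega>) \<in> E} \<omega> \<partial>M)"
      using measurable_sets[OF U A] measurable_sets[OF V E]
      by (intro nn_integral_indicator[symmetric])
        (auto simp: Int_def vimage_def conj_ac dest!: sets.Int)
    also have "\<dots> = (\<integral>\<^sup>+\<omega>. indicator E (sel \<omega>, lam (K + 1) \<omega>) * indicator A (?U \<omega>) \<partial>M)"
      by (intro nn_integral_cong) (auto simp: indicator_def)
    also have "\<dots> = (\<integral>\<^sup>+\<omega>. (\<Sum>is\<in>G. indicator {\<omega>. sel \<omega> = is} \<omega>
        * (indicator A (?U \<omega>) * indicator (Pair is -` E) (lam (K + 1) \<omega>))) \<partial>M)"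
      by (subst decompose) simp
    also have "\<dots> = (\<Sum>is\<in>G. \<integral>\<^sup>+\<omega>. indicator {\<omega>. sel \<omega> = is} \<omega>
        * (indicator A (?U \<omega>) * indicator (Pair is -` E) (lam (K + 1) \<omega>)) \<partial>M)"
      by (intro nn_integral_sum borel_measurable_times_ennreal sel_ind slice_ind A_ind)
    also have "\<dots> = (\<Sum>is\<in>G. \<integral>\<^sup>+\<omega>. indicator {\<omega>. sel \<omega> = is} \<omega>
        * (emeasure (lars_cond_law X \<beta> \<sigma> is (lam (K + 1) \<omega>)) A * indicator (Pair is -` E) (lam (K + 1) \<omega>)) \<partial>M)"
      unfolding sel_def
      by (intro sum.cong refl selected_tuple_kernel[OF reg(1) reg(2) assms(1) \<open>\<sigma> > 0\<close> \<eta> Y path A[unfolded S_def] slice])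
    also have "\<dots> = (\<integral>\<^sup>+\<omega>. (\<Sum>is\<in>G. indicator {\<omega>. sel \<omega> = is} \<omega>
        * (emeasure (lars_cond_law X \<beta> \<sigma> is (lam (K + 1) \<omega>)) A * indicator (Pair is -` E) (lam (K + 1) \<omega>))) \<partial>M)"
      by (intro nn_integral_sum[symmetric] borel_measurable_times_ennreal sel_ind slice_ind law)
    also have "\<dots> = (\<integral>\<^sup>+\<omega>. indicator E (sel \<omega>, lam (K + 1) \<omega>)
        * emeasure ((\<lambda>(is, x). lars_cond_law X \<beta> \<sigma> is x) (sel \<omega>, lam (K + 1) \<omega>)) A \<partial>M)"
      by (subst decompose) simp
    finally show "emeasure M {\<omega> \<in> space M. ?U \<omega> \<in> A \<and> (sel \<omega>, lam (K + 1) \<omega>) \<in> E}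
      = (\<integral>\<^sup>+\<omega>. indicator E (sel \<omega>, lam (K + 1) \<omega>)
        * emeasure ((\<lambda>(is, x). lars_cond_law X \<beta> \<sigma> is x) (sel \<omega>, lam (K + 1) \<omega>)) A \<partial>M)" .
  qed
  then show ?thesis unfolding S_def G_def sel_def .
qed

end
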